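(* The theory $\mathrm{DLO}_p$ satisfies New Kim's Lemma.
   Context: $\mathrm{DLO}_p$: the language has two sorts $O$ and $P$ and a ternary relation $y<_x z$ with $x$ of sort $P$, $y,z$ of sort $O$; $\mathcal{K}$ is the class of finite structures $A$ such that for each $a\in A_P$, $<_a$ is a linear order on $A_O$; $\mathrm{DLO}_p$ is the theory of the Fraïssé limit of $\mathcal{K}$. Work in a monster model $\mathbb{M}$. A global type is a complete type over $\mathbb{M}$; it is $M$-invariant if for all $\varphi(x;y)$ and $c\equiv_M c'$, $\varphi(x;c)\in q$ iff $\varphi(x;c')\in q$. A Morley sequence over $M$ for $q$ is $(b_i)_{i<\omega}$ with $b_i\models q|_{Mb_{<i}}$; $\varphi(x;b)$ divides along it if $\{\varphi(x;b_i)\}$ is inconsistent. $\varphi(x;b)$ Kim-divides over $M$ if it divides along some Morley sequence for some global $M$-invariant type extending $\mathrm{tp}(b/M)$; it Kim-forks if it implies a finite disjunction of Kim-dividing formulas (possibly with different parameters). $A\mathop{\smile\!\!\!\!\!\mid}^K_M B$: $\mathrm{tp}(A/MB)$ contains no Kim-forking formula over $M$. A global $M$-invariant $p$ is Kim-strict if for all sets $B$ and $a\models p|_{MB}$, $B\mathop{\smile\!\!\!\!\!\mid}^K_M a$. $\varphi(x;b)$ universally Kim-strictly divides over $M$ if it divides along Morley sequences for every global Kim-strict $M$-invariant type extending $\mathrm{tp}(b/M)$. A theory satisfies New Kim's Lemma if for all models $M$, every formula that Kim-divides over $M$ universally Kim-strictly divides over $M$. *)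

theory Defs
  imports Main
begin

unbundle cardinal_syntax

datatype srt = Osort | Psort

text \<open>\<open>less N x y z\<close> is the relation \<open>y <\<^sub>x z\<close>. Its values at ill-sorted triples, and at
  triples outside of the universe, are irrelevant: no definition below depends on them.\<close>

record 'a struc =
  univ :: "'a set"
  sort :: "'a \<Rightarrow> srt"
  less :: "'a \<Rightarrow> 'a \<Rightarrow> 'a \<Rightarrow> bool"

definition carrier :: "'a struc \<Rightarrow> srt \<Rightarrow> 'a set" where
  "carrier N s = {a \<in> univ N. sort N a = s}"

definition induced :: "'a struc \<Rightarrow> 'a set \<Rightarrow> 'a struc" where
  "induced N A = N\<lparr>univ := A\<rparr>"

definition embedding :: "('a \<Rightarrow> 'b) \<Rightarrow> 'a struc \<Rightarrow> 'b struc \<Rightarrow> bool" where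
  "embedding f N N' \<longleftrightarrow>
     inj_on f (univ N) \<and> f ` univ N \<subseteq> univ N' \<and>
     (\<forall>a\<in>univ N. sort N' (f a) = sort N a) \<and>
     (\<forall>x\<in>carrier N Psort. \<forall>y\<in>carrier N Osort. \<forall>z\<in>carrier N Osort.
        less N' (f x) (f y) (f z) \<longleftrightarrow> less N x y z)"

definition isomorphism :: "('a \<Rightarrow> 'b) \<Rightarrow> 'a struc \<Rightarrow> 'b struc \<Rightarrow> bool" where
  "isomorphism f N N' \<longleftrightarrow> embedding f N N' \<and> f ` univ N = univ N'"

text \<open>Variables are de Bruijn indices. A formula \<open>\<phi>\<close> in the free variables \<open>x\<^sub>0, \<dots>, x\<^sub>n\<^sub>-\<^sub>1\<close> is
  well-sorted for the list \<open>\<Gamma>\<close> of their sorts if \<open>wf_fm \<Gamma> \<phi>\<close>; it is evaluated at a list of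
  elements of the same sorts. \<open>Less i j k\<close> stands for \<open>less x\<^sub>i x\<^sub>j x\<^sub>k\<close>.\<close>

datatype fm =
    Bot
  | Eq nat nat
  | Less nat nat nat
  | Neg fm
  | Conj fm fm
  | Ex srt fm

primrec wf_fm :: "srt list \<Rightarrow> fm \<Rightarrow> bool" where
  "wf_fm \<Gamma> Bot \<longleftrightarrow> True"
| "wf_fm \<Gamma> (Eq i j) \<longleftrightarrow> i < length \<Gamma> \<and> j < length \<Gamma> \<and> \<Gamma> ! i = \<Gamma> ! j"
| "wf_fm \<Gamma> (Less i j k) \<longleftrightarrow>
     i < length \<Gamma> \<and> j < length \<Gamma> \<and> k < length \<Gamma> \<and>
     \<Gamma> ! i = Psort \<and> \<Gamma> ! j = Osort \<and> \<Gamma> ! k = Osort"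
| "wf_fm \<Gamma> (Neg \<phi>) \<longleftrightarrow> wf_fm \<Gamma> \<phi>"
| "wf_fm \<Gamma> (Conj \<phi> \<psi>) \<longleftrightarrow> wf_fm \<Gamma> \<phi> \<and> wf_fm \<Gamma> \<psi>"
| "wf_fm \<Gamma> (Ex s \<phi>) \<longleftrightarrow> wf_fm (s # \<Gamma>) \<phi>"

primrec sat :: "'a struc \<Rightarrow> 'a list \<Rightarrow> fm \<Rightarrow> bool" where
  "sat N e Bot \<longleftrightarrow> False"
| "sat N e (Eq i j) \<longleftrightarrow> e ! i = e ! j"
| "sat N e (Less i j k) \<longleftrightarrow> less N (e ! i) (e ! j) (e ! k)"
| "sat N e (Neg \<phi>) \<longleftrightarrow> \<not> sat N e \<phi>"
| "sat N e (Conj \<phi> \<psi>) \<longleftrightarrow> sat N e \<phi> \<and> sat N e \<psi>"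
| "sat N e (Ex s \<phi>) \<longleftrightarrow> (\<exists>a\<in>carrier N s. sat N (a # e) \<phi>)"

definition sorts :: "'a struc \<Rightarrow> 'a list \<Rightarrow> srt list" where
  "sorts N as = map (sort N) as"

definition tuples :: "'a struc \<Rightarrow> srt list \<Rightarrow> 'a list set" where
  "tuples N \<sigma> = {as. set as \<subseteq> univ N \<and> sorts N as = \<sigma>}"

definition Th :: "'a struc \<Rightarrow> fm set" where
  "Th N = {\<phi>. wf_fm [] \<phi> \<and> sat N [] \<phi>}"

definition models :: "'a struc \<Rightarrow> fm set \<Rightarrow> bool" where
  "models N T \<longleftrightarrow> (\<forall>\<phi>\<in>T. sat N [] \<phi>)"

definition elementary_sub :: "'a set \<Rightarrow> 'a struc \<Rightarrow> bool" where
  "elementary_sub M N \<longleftrightarrow> M \<subseteq> univ N \<and>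
     (\<forall>as \<phi>. set as \<subseteq> M \<and> wf_fm (sorts N as) \<phi> \<longrightarrow>
        (sat (induced N M) as \<phi> \<longleftrightarrow> sat N as \<phi>))"

definition automorphism :: "('a \<Rightarrow> 'a) \<Rightarrow> 'a struc \<Rightarrow> bool" where
  "automorphism g N \<longleftrightarrow> isomorphism g N N"

definition ultrahomogeneous :: "'a struc \<Rightarrow> bool" where
  "ultrahomogeneous N \<longleftrightarrow>
     (\<forall>A B f. finite A \<and> A \<subseteq> univ N \<and> B \<subseteq> univ N \<and>
        isomorphism f (induced N A) (induced N B) \<longrightarrow>
        (\<exists>g. automorphism g N \<and> (\<forall>a\<in>A. g a = f a)))"

definition age :: "'a struc \<Rightarrow> nat struc set" where
  "age N = {A. finite (univ A) \<and> (\<exists>f. embedding f A N)}"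

text \<open>Countability of the limit is built into the type \<open>nat struc\<close>.\<close>

definition fraisse_limit :: "nat struc set \<Rightarrow> nat struc \<Rightarrow> bool" where
  "fraisse_limit K F \<longleftrightarrow> ultrahomogeneous F \<and> age F = K"

definition DLOp_class :: "nat struc set" where
  "DLOp_class = {A. finite (univ A) \<and>
     (\<forall>a\<in>carrier A Psort.
        strict_linear_order_on (carrier A Osort)
          {(y, z). y \<in> carrier A Osort \<and> z \<in> carrier A Osort \<and> less A a y z})}"

text \<open>The Fraisse limit exists and is unique up to isomorphism, so this is the theory of any one
  of its copies.\<close>

definition DLOp :: "fm set" where
  "DLOp = {\<phi>. wf_fm [] \<phi> \<and> (\<forall>F. fraisse_limit DLOp_class F \<longrightarrow> \<phi> \<in> Th F)}"

text \<open>A formula \<open>\<phi>(x;c)\<close> over a parameter set, with \<open>x\<close> a tuple of variables of sorts \<open>\<sigma>\<close>, is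
  represented by the pair \<open>(\<phi>, c)\<close>, where the variables of \<open>\<phi>\<close> are \<open>x\<close> followed by those for
  \<open>c\<close>.\<close>

definition formulas_over :: "'a struc \<Rightarrow> 'a set \<Rightarrow> srt list \<Rightarrow> (fm \<times> 'a list) set" where
  "formulas_over N A \<sigma> = {(\<phi>, c). set c \<subseteq> A \<and> wf_fm (\<sigma> @ sorts N c) \<phi>}"

definition realizes :: "'a struc \<Rightarrow> 'a list \<Rightarrow> (fm \<times> 'a list) set \<Rightarrow> bool" where
  "realizes N a p \<longleftrightarrow> (\<forall>(\<phi>, c)\<in>p. sat N (a @ c) \<phi>)"

definition consistent :: "'a struc \<Rightarrow> srt list \<Rightarrow> (fm \<times> 'a list) set \<Rightarrow> bool" where
  "consistent N \<sigma> p \<longleftrightarrow> (\<forall>p0. finite p0 \<and> p0 \<subseteq> p \<longrightarrow> (\<exists>a\<in>tuples N \<sigma>. realizes N a p0))"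

definition tp :: "'a struc \<Rightarrow> 'a set \<Rightarrow> 'a list \<Rightarrow> (fm \<times> 'a list) set" where
  "tp N A a = {(\<phi>, c) \<in> formulas_over N A (sorts N a). sat N (a @ c) \<phi>}"

definition saturated :: "'a rel \<Rightarrow> 'a struc \<Rightarrow> bool" where
  "saturated \<kappa> N \<longleftrightarrow>
     (\<forall>A \<sigma> p. A \<subseteq> univ N \<and> |A| <o \<kappa> \<and> p \<subseteq> formulas_over N A \<sigma> \<and> consistent N \<sigma> p \<longrightarrow>
        (\<exists>a\<in>tuples N \<sigma>. realizes N a p))"

definition partial_elementary :: "('a \<Rightarrow> 'a) \<Rightarrow> 'a set \<Rightarrow> 'a struc \<Rightarrow> bool" where
  "partial_elementary f A N \<longleftrightarrow>
     f ` A \<subseteq> univ N \<and> (\<forall>a\<in>A. sort N (f a) = sort N a) \<and>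
     (\<forall>as \<phi>. set as \<subseteq> A \<and> wf_fm (sorts N as) \<phi> \<longrightarrow> (sat N (map f as) \<phi> \<longleftrightarrow> sat N as \<phi>))"

definition strongly_homogeneous :: "'a rel \<Rightarrow> 'a struc \<Rightarrow> bool" where
  "strongly_homogeneous \<kappa> N \<longleftrightarrow>
     (\<forall>A f. A \<subseteq> univ N \<and> |A| <o \<kappa> \<and> partial_elementary f A N \<longrightarrow>
        (\<exists>g. automorphism g N \<and> (\<forall>a\<in>A. g a = f a)))"

text \<open>The cardinal \<open>\<kappa>\<close> bounds the small sets. Taking it on the element type is no restriction,
  since an infinite \<open>\<kappa>\<close>-saturated structure has at least \<open>\<kappa>\<close> elements.\<close>

definition monster :: "fm set \<Rightarrow> 'a rel \<Rightarrow> 'a struc \<Rightarrow> bool" where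
  "monster T \<kappa> N \<longleftrightarrow>
     Card_order \<kappa> \<and> natLeq <o \<kappa> \<and> models N T \<and> saturated \<kappa> N \<and> strongly_homogeneous \<kappa> N"

definition global_type :: "'a struc \<Rightarrow> srt list \<Rightarrow> (fm \<times> 'a list) set \<Rightarrow> bool" where
  "global_type N \<sigma> q \<longleftrightarrow>
     q \<subseteq> formulas_over N (univ N) \<sigma> \<and> consistent N \<sigma> q \<and>
     (\<forall>(\<phi>, c)\<in>formulas_over N (univ N) \<sigma>. (\<phi>, c) \<in> q \<or> (Neg \<phi>, c) \<in> q)"

definition equiv_over :: "'a struc \<Rightarrow> 'a set \<Rightarrow> 'a list \<Rightarrow> 'a list \<Rightarrow> bool" where
  "equiv_over N M c c' \<longleftrightarrow> sorts N c = sorts N c' \<and> tp N M c = tp N M c'"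

definition invariant_type :: "'a struc \<Rightarrow> 'a set \<Rightarrow> srt list \<Rightarrow> (fm \<times> 'a list) set \<Rightarrow> bool" where
  "invariant_type N M \<sigma> q \<longleftrightarrow> global_type N \<sigma> q \<and>
     (\<forall>\<phi> c c'. set c \<subseteq> univ N \<and> set c' \<subseteq> univ N \<and> wf_fm (\<sigma> @ sorts N c) \<phi> \<and>
        equiv_over N M c c' \<longrightarrow> ((\<phi>, c) \<in> q \<longleftrightarrow> (\<phi>, c') \<in> q))"

definition restrict_type :: "(fm \<times> 'a list) set \<Rightarrow> 'a set \<Rightarrow> (fm \<times> 'a list) set" where
  "restrict_type q A = {(\<phi>, c) \<in> q. set c \<subseteq> A}"

definition morley_sequence ::
  "'a struc \<Rightarrow> 'a set \<Rightarrow> srt list \<Rightarrow> (fm \<times> 'a list) set \<Rightarrow> (nat \<Rightarrow> 'a list) \<Rightarrow> bool" where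
  "morley_sequence N M \<tau> q bs \<longleftrightarrow>
     (\<forall>i. bs i \<in> tuples N \<tau> \<and> realizes N (bs i) (restrict_type q (M \<union> (\<Union>j<i. set (bs j)))))"

definition divides_along :: "'a struc \<Rightarrow> srt list \<Rightarrow> fm \<Rightarrow> (nat \<Rightarrow> 'a list) \<Rightarrow> bool" where
  "divides_along N \<sigma> \<phi> bs \<longleftrightarrow> \<not> consistent N \<sigma> (range (\<lambda>i. (\<phi>, bs i)))"

definition kim_divides :: "'a struc \<Rightarrow> 'a set \<Rightarrow> srt list \<Rightarrow> fm \<Rightarrow> 'a list \<Rightarrow> bool" where
  "kim_divides N M \<sigma> \<phi> b \<longleftrightarrow>
     (\<exists>q bs. invariant_type N M (sorts N b) q \<and> tp N M b \<subseteq> q \<and>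
        morley_sequence N M (sorts N b) q bs \<and> divides_along N \<sigma> \<phi> bs)"

definition kim_forks :: "'a struc \<Rightarrow> 'a set \<Rightarrow> srt list \<Rightarrow> fm \<Rightarrow> 'a list \<Rightarrow> bool" where
  "kim_forks N M \<sigma> \<phi> b \<longleftrightarrow>
     (\<exists>D. finite D \<and> D \<subseteq> formulas_over N (univ N) \<sigma> \<and>
        (\<forall>(\<psi>, d)\<in>D. kim_divides N M \<sigma> \<psi> d) \<and>
        (\<forall>a\<in>tuples N \<sigma>. sat N (a @ b) \<phi> \<longrightarrow> (\<exists>(\<psi>, d)\<in>D. sat N (a @ d) \<psi>)))"

text \<open>A formula of the type of the set \<open>A\<close> over \<open>M \<union> B\<close> belongs to the type of a finite tuple
  from \<open>A\<close>.\<close>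

definition kim_indep :: "'a struc \<Rightarrow> 'a set \<Rightarrow> 'a set \<Rightarrow> 'a set \<Rightarrow> bool" where
  "kim_indep N M A B \<longleftrightarrow>
     (\<forall>a. set a \<subseteq> A \<longrightarrow> (\<forall>(\<phi>, c)\<in>tp N (M \<union> B) a. \<not> kim_forks N M (sorts N a) \<phi> c))"

definition kim_strict ::
  "'a rel \<Rightarrow> 'a struc \<Rightarrow> 'a set \<Rightarrow> srt list \<Rightarrow> (fm \<times> 'a list) set \<Rightarrow> bool" where
  "kim_strict \<kappa> N M \<sigma> p \<longleftrightarrow> invariant_type N M \<sigma> p \<and>
     (\<forall>B a. B \<subseteq> univ N \<and> |B| <o \<kappa> \<and> a \<in> tuples N \<sigma> \<and> realizes N a (restrict_type p (M \<union> B)) \<longrightarrow>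
        kim_indep N M B (set a))"

definition universally_kim_strictly_divides ::
  "'a rel \<Rightarrow> 'a struc \<Rightarrow> 'a set \<Rightarrow> srt list \<Rightarrow> fm \<Rightarrow> 'a list \<Rightarrow> bool" where
  "universally_kim_strictly_divides \<kappa> N M \<sigma> \<phi> b \<longleftrightarrow>
     (\<forall>q bs. kim_strict \<kappa> N M (sorts N b) q \<and> tp N M b \<subseteq> q \<and>
        morley_sequence N M (sorts N b) q bs \<longrightarrow> divides_along N \<sigma> \<phi> bs)"

text \<open>The first argument is the type of the elements of the monster models. Every small model lies
  in a monster model over a sufficiently large type, so the property of \<open>T\<close> is the statement for
  all \<open>'a\<close>.\<close>

definition new_kims_lemma :: "'a itself \<Rightarrow> fm set \<Rightarrow> bool" where
  "new_kims_lemma _ T \<longleftrightarrow>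
     (\<forall>(\<kappa> :: 'a rel) N M. monster T \<kappa> N \<and> elementary_sub M N \<and> |M| <o \<kappa> \<longrightarrow>
        (\<forall>\<sigma> \<phi> b. (\<phi>, b) \<in> formulas_over N (univ N) \<sigma> \<and> kim_divides N M \<sigma> \<phi> b \<longrightarrow>
           universally_kim_strictly_divides \<kappa> N M \<sigma> \<phi> b))"

end

theory Submission
  imports Defs
begin

text \<open>The theory \<open>DLOp\<close> contains, for every finite structure \<open>E\<close> all of whose relations \<open><\<^sub>p\<close> are
  linear orders, the axiom that embeddings extend over one more point of \<open>E\<close>; this gives
  quantifier elimination. By it, a formula \<open>\<phi>(x;b)\<close> with a solution \<open>a\<close> can divide along a Morley
  sequence of an \<open>M\<close>-invariant type only for one of two reasons: \<open>a\<close> and \<open>b\<close> share an element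
  outside of \<open>M\<close>, or, for some \<open>p\<close> in \<open>M\<close> and \<open>b\<close>, an entry of \<open>a\<close> lies \<open><\<^sub>p\<close>-between two
  entries of \<open>b\<close> that realize the same \<open><\<^sub>p\<close>-cut over \<open>M\<close>. In every other case the copies of \<open>a\<close> over
  the members of the sequence can be amalgamated.

  Conversely, an \<open>M\<close>-invariant type puts each variable to the left or to the right of all points of
  its \<open><\<^sub>p\<close>-cut over \<open>M\<close>. A formula \<open>d <\<^sub>p y <\<^sub>p e\<close> with \<open>d\<close>, \<open>e\<close> in the same cut Kim-divides, since
  both ends can be sent to the left; hence a Kim-strict type cannot put \<open>d\<close> to the left and \<open>e\<close>
  to the right, and the intervals between corresponding entries are disjoint along its Morley
  sequences. So if \<open>\<phi>(x;b)\<close> Kim-divides, a solution of sufficiently many instances along a Kim-strict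
  Morley sequence would, by the pigeonhole principle, lie in two disjoint intervals, or share one
  element outside of \<open>M\<close> with two members of the sequence.\<close>

section \<open>Extension axioms and quantifier elimination\<close>

definition lin_on :: "'a set \<Rightarrow> ('a \<Rightarrow> 'a \<Rightarrow> bool) \<Rightarrow> bool" where
  "lin_on X R \<longleftrightarrow> (\<forall>x\<in>X. \<forall>y\<in>X. \<not> R x x \<and> (x = y \<or> R x y \<or> R y x) \<and>
     (\<forall>z\<in>X. R x y \<longrightarrow> R y z \<longrightarrow> R x z))"

text \<open>The condition defining \<open>DLOp_class\<close>, without finiteness and over any
  element type. Extensions of a model will be built as structures of this kind.\<close>

definition linear :: "'a struc \<Rightarrow> bool" where
  "linear N \<longleftrightarrow> (\<forall>p\<in>carrier N Psort. lin_on (carrier N Osort) (less N p))"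

lemma lin_on_mono: "lin_on X R \<Longrightarrow> Y \<subseteq> X \<Longrightarrow> lin_on Y R"
  unfolding lin_on_def by blast

lemma lin_onI:
  assumes "\<And>x. x \<in> X \<Longrightarrow> \<not> R x x"
    and "\<And>x y. x \<in> X \<Longrightarrow> y \<in> X \<Longrightarrow> x \<noteq> y \<Longrightarrow> R x y \<or> R y x"
    and "\<And>x y z. x \<in> X \<Longrightarrow> y \<in> X \<Longrightarrow> z \<in> X \<Longrightarrow> R x y \<Longrightarrow> R y z \<Longrightarrow> R x z"
  shows "lin_on X R"
  unfolding lin_on_def using assms by blast

lemma
  assumes "lin_on X R" "x \<in> X"
  shows lin_on_irrefl: "\<not> R x x"
    and lin_on_total: "y \<in> X \<Longrightarrow> x = y \<or> R x y \<or> R y x"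
    and lin_on_trans: "y \<in> X \<Longrightarrow> z \<in> X \<Longrightarrow> R x y \<Longrightarrow> R y z \<Longrightarrow> R x z"
    and lin_on_asym: "y \<in> X \<Longrightarrow> R x y \<Longrightarrow> \<not> R y x"
  using assms unfolding lin_on_def by blast+

lemma lin_on_pullback:
  assumes R: "lin_on Y R" and f: "inj_on f X" "f ` X \<subseteq> Y"
  shows "lin_on X (\<lambda>x y. R (f x) (f y))"
proof (rule lin_onI)
  have fY: "f x \<in> Y" if "x \<in> X" for x
    using f(2) that by auto
  show "\<not> R (f x) (f x)" if "x \<in> X" for x
    using lin_on_irrefl[OF R fY[OF that]] .
  show "R (f x) (f y) \<or> R (f y) (f x)" if "x \<in> X" "y \<in> X" "x \<noteq> y" for x y
    using lin_on_total[OF R fY fY] f(1) that by (auto dest: inj_onD)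
  show "R (f x) (f z)" if "x \<in> X" "y \<in> X" "z \<in> X" "R (f x) (f y)" "R (f y) (f z)" for x y z
    using lin_on_trans[OF R fY fY fY] that by blast
qed

lemma linearI:
  assumes "\<And>p x. p \<in> carrier N Psort \<Longrightarrow> x \<in> carrier N Osort \<Longrightarrow> \<not> less N p x x"
    and "\<And>p x y. p \<in> carrier N Psort \<Longrightarrow> x \<in> carrier N Osort \<Longrightarrow> y \<in> carrier N Osort \<Longrightarrow>
      x \<noteq> y \<Longrightarrow> less N p x y \<or> less N p y x"
    and "\<And>p x y z. p \<in> carrier N Psort \<Longrightarrow> x \<in> carrier N Osort \<Longrightarrow> y \<in> carrier N Osort \<Longrightarrow>
      z \<in> carrier N Osort \<Longrightarrow> less N p x y \<Longrightarrow> less N p y z \<Longrightarrow> less N p x z"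
  shows "linear N"
  unfolding linear_def lin_on_def using assms by blast

lemma
  assumes "linear N" "p \<in> carrier N Psort" "x \<in> carrier N Osort"
  shows linear_irrefl: "\<not> less N p x x"
    and linear_total: "y \<in> carrier N Osort \<Longrightarrow> x = y \<or> less N p x y \<or> less N p y x"
    and linear_trans: "y \<in> carrier N Osort \<Longrightarrow> z \<in> carrier N Osort \<Longrightarrow>
      less N p x y \<Longrightarrow> less N p y z \<Longrightarrow> less N p x z"
  using assms unfolding linear_def lin_on_def by blast+

lemma strict_linear_order_on_iff:
  "strict_linear_order_on X {(y, z). y \<in> X \<and> z \<in> X \<and> R y z} \<longleftrightarrow> lin_on X R"
  unfolding lin_on_def strict_linear_order_on_def trans_def irrefl_def total_on_def by simp blast

lemma DLOp_class_iff: "A \<in> DLOp_class \<longleftrightarrow> finite (univ A) \<and> linear A"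
  unfolding DLOp_class_def linear_def strict_linear_order_on_iff by simp

lemma induced_simps [simp]:
  "univ (induced N A) = A" "sort (induced N A) = sort N" "less (induced N A) = less N"
  "carrier (induced N A) s = {a \<in> A. sort N a = s}"
  by (auto simp: induced_def carrier_def)

section \<open>Embeddings of induced substructures\<close>

lemma embedding_induced_iff:
  "embedding g (induced E S) N \<longleftrightarrow> inj_on g S \<and> g ` S \<subseteq> univ N \<and>
     (\<forall>a\<in>S. sort N (g a) = sort E a) \<and>
     (\<forall>x\<in>S. \<forall>y\<in>S. \<forall>z\<in>S. sort E x = Psort \<longrightarrow> sort E y = Osort \<longrightarrow> sort E z = Osort \<longrightarrow>
        less N (g x) (g y) (g z) = less E x y z)"
  unfolding embedding_def by auto

lemma
  assumes "embedding g (induced E S) N"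
  shows embedding_univ: "x \<in> S \<Longrightarrow> g x \<in> univ N"
    and embedding_sort: "x \<in> S \<Longrightarrow> sort N (g x) = sort E x"
    and embedding_eq_iff: "x \<in> S \<Longrightarrow> y \<in> S \<Longrightarrow> g x = g y \<longleftrightarrow> x = y"
    and embedding_less: "x \<in> S \<Longrightarrow> y \<in> S \<Longrightarrow> z \<in> S \<Longrightarrow>
      sort E x = Psort \<Longrightarrow> sort E y = Osort \<Longrightarrow> sort E z = Osort \<Longrightarrow>
      less N (g x) (g y) (g z) = less E x y z"
  using assms by (auto simp: embedding_induced_iff inj_on_eq_iff)

text \<open>The axioms of a linear order are universal, hence inherited along embeddings.\<close>

lemma linear_embedding:
  assumes f: "embedding f A B" and B: "linear B"
  shows "linear A"
proof -
  have c: "f a \<in> carrier B s" if "a \<in> carrier A s" for a s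
    using f that by (auto simp: embedding_def carrier_def)
  have l: "less A p y z \<longleftrightarrow> less B (f p) (f y) (f z)"
    if "p \<in> carrier A Psort" "y \<in> carrier A Osort" "z \<in> carrier A Osort" for p y z
    using f that by (auto simp: embedding_def)
  have i: "f x = f y \<longleftrightarrow> x = y" if "x \<in> carrier A s" "y \<in> carrier A s" for x y s
    using f that unfolding embedding_def carrier_def inj_on_def by blast
  show ?thesis
    unfolding linear_def lin_on_def
  proof (intro ballI conjI impI)
    fix p x y assume a: "p \<in> carrier A Psort" "x \<in> carrier A Osort" "y \<in> carrier A Osort"
    note * = B[unfolded linear_def lin_on_def, rule_format, OF c[OF a(1)] c[OF a(2)] c[OF a(3)]]
    show "\<not> less A p x x" "x = y \<or> less A p x y \<or> less A p y x"
      using * l[OF a(1,2,2)] l[OF a] l[OF a(1,3,2)] i[OF a(2,3)] by simp_all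
    fix z assume z: "z \<in> carrier A Osort" "less A p x y" "less A p y z"
    then show "less A p x z"
      using * c[OF z(1)] l[OF a] l[OF a(1,2) z(1)] l[OF a(1,3) z(1)] by simp
  qed
qed

lemma embedding_comp:
  assumes "embedding f (induced A S) B" "embedding g (induced B T) C" "f ` S \<subseteq> T"
  shows "embedding (g \<circ> f) (induced A S) C"
  using assms unfolding embedding_induced_iff
  by (simp add: image_subset_iff subsetD inj_on_def)

lemma embedding_comp_univ:
  assumes "embedding f (induced A S) B" "embedding g B C"
  shows "embedding (g \<circ> f) (induced A S) C"
proof -
  have "embedding g (induced B (univ B)) C"
    using assms(2) by (simp add: induced_def)
  then show ?thesis
    by (rule embedding_comp[OF assms(1)]) (use assms(1) in \<open>simp add: embedding_def\<close>)
qed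

lemma embedding_inv:
  assumes "embedding f (induced A S) B" "S \<subseteq> univ A"
  shows "embedding (inv_into S f) (induced B (f ` S)) A"
  using assms unfolding embedding_induced_iff
  by (auto simp: inj_on_inv_into inv_into_f_f)

lemma embedding_cong:
  assumes "embedding f (induced A S) B" "\<And>x. x \<in> S \<Longrightarrow> g x = f x"
  shows "embedding g (induced A S) B"
  using assms unfolding embedding_induced_iff
  by (auto simp: inj_on_def)

lemma embedding_mono:
  assumes "embedding f (induced A S) B" "T \<subseteq> S"
  shows "embedding f (induced A T) B"
  using assms unfolding embedding_induced_iff
  by (simp add: image_subset_iff subsetD inj_on_def)

section \<open>Diagrams of finite tuples\<close>

primrec bigconj :: "fm list \<Rightarrow> fm" where
  "bigconj [] = Neg Bot"
| "bigconj (\<phi> # l) = Conj \<phi> (bigconj l)"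

lemma sat_bigconj: "sat N e (bigconj l) \<longleftrightarrow> (\<forall>\<phi>\<in>set l. sat N e \<phi>)"
  by (induction l) auto

lemma wf_bigconj: "wf_fm \<Gamma> (bigconj l) \<longleftrightarrow> (\<forall>\<phi>\<in>set l. wf_fm \<Gamma> \<phi>)"
  by (induction l) auto

definition atoms :: "nat \<Rightarrow> fm list" where
  "atoms n = [Eq i j. i \<leftarrow> [0..<n], j \<leftarrow> [0..<n]] @
     [Less i j k. i \<leftarrow> [0..<n], j \<leftarrow> [0..<n], k \<leftarrow> [0..<n]]"

lemma ball_atoms:
  "(\<forall>\<alpha>\<in>set (atoms n). P \<alpha>) \<longleftrightarrow> (\<forall>i<n. \<forall>j<n. P (Eq i j)) \<and> (\<forall>i<n. \<forall>j<n. \<forall>k<n. P (Less i j k))"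
  unfolding atoms_def by (simp add: ball_Un) (auto simp: Ball_def)

text \<open>The quantifier-free diagram of \<open>e\<close>. Filtering by \<open>wf_fm\<close>
  discards the ill-sorted members of \<open>atoms\<close>; the equality atoms record repetitions in
  \<open>e\<close>.\<close>

definition diag :: "'a struc \<Rightarrow> 'a list \<Rightarrow> fm" where
  "diag E e = bigconj (map (\<lambda>\<alpha>. if sat E e \<alpha> then \<alpha> else Neg \<alpha>)
     (filter (wf_fm (sorts E e)) (atoms (length e))))"

lemma wf_diag: "wf_fm (sorts E e) (diag E e)"
  unfolding diag_def by (auto simp: wf_bigconj)

lemma sat_diag:
  "sat N d (diag E e) \<longleftrightarrow>
     (\<forall>\<alpha>\<in>set (atoms (length e)). wf_fm (sorts E e) \<alpha> \<longrightarrow> (sat N d \<alpha> \<longleftrightarrow> sat E e \<alpha>))"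
proof -
  have "sat N d (if sat E e \<alpha> then \<alpha> else Neg \<alpha>) \<longleftrightarrow> (sat N d \<alpha> \<longleftrightarrow> sat E e \<alpha>)" for \<alpha>
    by simp
  then show ?thesis
    unfolding diag_def by (simp only: sat_bigconj set_map ball_simps) auto
qed

lemma sat_diag_iff:
  assumes "length d = length e"
  shows "sat N d (diag E e) \<longleftrightarrow>
     (\<forall>i<length e. \<forall>j<length e. sort E (e ! i) = sort E (e ! j) \<longrightarrow> (d ! i = d ! j \<longleftrightarrow> e ! i = e ! j)) \<and>
     (\<forall>i<length e. \<forall>j<length e. \<forall>k<length e.
        sort E (e ! i) = Psort \<longrightarrow> sort E (e ! j) = Osort \<longrightarrow> sort E (e ! k) = Osort \<longrightarrow>
        (less N (d ! i) (d ! j) (d ! k) \<longleftrightarrow> less E (e ! i) (e ! j) (e ! k)))"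
  unfolding sat_diag ball_atoms by (simp add: sorts_def imp_conjL)

lemma sat_diag_embedding:
  assumes "embedding g (induced E (set e)) N"
  shows "sat N (map g e) (diag E e)"
  using assms unfolding embedding_induced_iff
  by (subst sat_diag_iff) (auto simp: inj_on_def)

text \<open>Converse of \<open>sat_diag_embedding\<close>. Entries of \<open>e\<close> may repeat,
  so the map is read off at one chosen position \<open>ix x\<close> of each element; the equality
  atoms make the choice irrelevant.\<close>

lemma embedding_of_diag:
  assumes d: "d \<in> tuples N (sorts E e)" and s: "sat N d (diag E e)"
  obtains g where "embedding g (induced E (set e)) N" "map g e = d"
proof -
  have len: "length d = length e" and so: "\<And>i. i < length e \<Longrightarrow> sort N (d ! i) = sort E (e ! i)"
    using d by (auto simp: tuples_def sorts_def dest: arg_cong[where f = length] map_eq_imp_length_eq)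
       (metis map_eq_imp_length_eq nth_map)
  have un: "\<And>i. i < length e \<Longrightarrow> d ! i \<in> univ N"
    using d len by (auto simp: tuples_def)
  define ix where "ix x = (SOME i. i < length e \<and> e ! i = x)" for x
  define g where "g x = d ! ix x" for x
  have ix: "ix x < length e \<and> e ! ix x = x" if "x \<in> set e" for x
    unfolding ix_def by (rule someI_ex) (use that in \<open>auto simp: in_set_conv_nth\<close>)
  \<comment> \<open>No well-sorted equality joins entries of different sorts; such entries differ on
    both sides because \<open>d\<close> has the sorts of \<open>e\<close>.\<close>
  have eq: "d ! i = d ! j \<longleftrightarrow> e ! i = e ! j" if "i < length e" "j < length e" for i j
    using s that so unfolding sat_diag_iff[OF len] by metis
  have gi: "g (e ! i) = d ! i" if "i < length e" for i
    using that ix[of "e ! i"] eq[of "ix (e ! i)" i] by (simp add: g_def)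
  have "map g e = d"
    using len gi by (auto intro: nth_equalityI)
  moreover have "embedding g (induced E (set e)) N"
    using s gi eq so un unfolding embedding_induced_iff sat_diag_iff[OF len]
    by (auto simp: inj_on_def in_set_conv_nth)
  ultimately show thesis using that by blast
qed

text \<open>Index 0 belongs to the head of the context, so the first sort is bound
  innermost.\<close>

primrec exs :: "srt list \<Rightarrow> fm \<Rightarrow> fm" where
  "exs [] \<phi> = \<phi>"
| "exs (s # \<Gamma>) \<phi> = exs \<Gamma> (Ex s \<phi>)"

lemma wf_exs: "wf_fm \<Gamma> \<phi> \<Longrightarrow> wf_fm [] (exs \<Gamma> \<phi>)"
  by (induction \<Gamma> arbitrary: \<phi>) auto

lemma tuples_Nil [simp]: "tuples N [] = {[]}"
  by (auto simp: tuples_def sorts_def)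

lemma tuples_Cons: "x \<in> tuples N (s # \<Gamma>) \<longleftrightarrow> (\<exists>a d. x = a # d \<and> a \<in> carrier N s \<and> d \<in> tuples N \<Gamma>)"
  by (cases x) (auto simp: tuples_def sorts_def carrier_def)

lemma sat_exs: "sat N [] (exs \<Gamma> \<phi>) \<longleftrightarrow> (\<exists>d\<in>tuples N \<Gamma>. sat N d \<phi>)"
  by (induction \<Gamma> arbitrary: \<phi>) (auto simp: tuples_Cons Bex_def)

section \<open>The Fraisse limit: extension property and linearity\<close>

lemma nat_copy:
  fixes E :: "'b struc"
  assumes "finite S" "S \<subseteq> univ E" "linear E"
  obtains A :: "nat struc" and h where "A \<in> DLOp_class" "embedding h (induced E S) A"
proof -
  obtain h :: "'b \<Rightarrow> nat" where h: "inj_on h S"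
    using assms(1) finite_imp_inj_to_nat_seg by blast
  define k where "k = inv_into S h"
  have k: "k (h x) = x" if "x \<in> S" for x
    using h that by (simp add: k_def)
  define A where "A = \<lparr>univ = h ` S, sort = (\<lambda>n. sort E (k n)), less = (\<lambda>x y z. less E (k x) (k y) (k z))\<rparr>"
  have "embedding k A E"
    using k assms(2) by (auto simp: A_def embedding_def carrier_def inj_on_def)
  then have "linear A"
    using assms(3) linear_embedding by blast
  moreover have "finite (univ A)"
    using assms by (simp add: A_def)
  moreover have "embedding h (induced E S) A"
    using h k unfolding embedding_induced_iff by (auto simp: A_def)
  ultimately show thesis
    using that DLOp_class_iff by blast
qed

text \<open>The finite structure on \<open>x # c\<close> embeds into \<open>F\<close> because it
  lies in the age, and ultrahomogeneity moves the image of \<open>c\<close> onto \<open>d\<close>;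
  the image of \<open>x\<close> moves along.\<close>

lemma limit_extension:
  fixes E :: "'b struc"
  assumes F: "fraisse_limit DLOp_class F" and E: "linear E" "set (x # c) \<subseteq> univ E"
    and d: "d \<in> tuples F (sorts E c)" "sat F d (diag E c)"
  shows "\<exists>y\<in>carrier F (sort E x). sat F (y # d) (diag E (x # c))"
proof -
  obtain g0 where g0: "embedding g0 (induced E (set c)) F" "map g0 c = d"
    using embedding_of_diag[OF d] .
  \<comment> \<open>The age consists of structures on natural numbers, while \<open>E\<close> has
    any element type; hence the copy.\<close>
  obtain A h where A: "A \<in> DLOp_class" "embedding h (induced E (set (x # c))) A"
    using nat_copy[of "set (x # c)" E] E by blast
  have "A \<in> age F"
    using A(1) F by (simp add: fraisse_limit_def)
  then obtain f where f: "embedding f A F"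
    by (auto simp: age_def)
  define g where "g = f \<circ> h"
  have g: "embedding g (induced E (set (x # c))) F"
    unfolding g_def by (rule embedding_comp_univ[OF A(2) f])
  then have gc: "embedding g (induced E (set c)) F"
    by (rule embedding_mono) auto
  \<comment> \<open>The finite partial isomorphism of \<open>F\<close> from the copy of
    \<open>c\<close> given by the age to the prescribed copy \<open>d\<close>.\<close>
  define k where "k = g0 \<circ> inv_into (set c) g"
  have inv: "embedding (inv_into (set c) g) (induced F (g ` set c)) E"
    using embedding_inv[OF gc] E by auto
  have k: "embedding k (induced F (g ` set c)) F"
    unfolding k_def by (rule embedding_comp[OF inv g0(1)]) (auto intro: inv_into_into)
  have kg: "k (g y) = g0 y" if "y \<in> set c" for y
    using gc that by (simp add: k_def embedding_induced_iff)
  have im: "k ` g ` set c = set d"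
    using kg by (simp add: image_image flip: g0(2))
  have "isomorphism k (induced F (g ` set c)) (induced F (set d))"
    using k im unfolding isomorphism_def embedding_induced_iff by simp
  moreover have "g ` set c \<subseteq> univ F" "set d \<subseteq> univ F"
    using gc d by (auto simp: embedding_induced_iff tuples_def)
  ultimately obtain H where H: "automorphism H F" "\<forall>a\<in>g ` set c. H a = k a"
    using F[unfolded fraisse_limit_def ultrahomogeneous_def, THEN conjunct1, rule_format,
        of "g ` set c" "set d" k] by auto
  have e: "embedding (H \<circ> g) (induced E (set (x # c))) F"
    using H(1) g by (intro embedding_comp_univ) (auto simp: automorphism_def isomorphism_def)
  have "map (H \<circ> g) c = d"
    using H(2) kg by (simp flip: g0(2))
  then have "sat F (H (g x) # d) (diag E (x # c))"
    using sat_diag_embedding[OF e] by simp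
  moreover have "H (g x) \<in> carrier F (sort E x)"
    using e by (auto simp: carrier_def embedding_induced_iff)
  ultimately show ?thesis by blast
qed

text \<open>Each axiom of linearity concerns at most four elements, and substructures of
  \<open>F\<close> with at most four elements are in its age.\<close>

lemma limit_linear:
  assumes F: "fraisse_limit DLOp_class F"
  shows "linear F"
proof -
  have fin: "linear (induced F A)" if "finite A" "A \<subseteq> univ F" for A
  proof -
    have "embedding id (induced F A) F"
      using that by (auto simp: embedding_induced_iff)
    then have "induced F A \<in> age F"
      using that by (auto simp: age_def)
    then show ?thesis
      using F by (simp add: fraisse_limit_def DLOp_class_iff)
  qed
  have c: "w \<in> carrier (induced F {p, x, y, z}) s" if "w \<in> carrier F s" "w \<in> {p, x, y, z}"
    for p x y z w s
    using that by (simp add: carrier_def)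
  show ?thesis
  proof (rule linearI)
    fix p x y z
    assume a: "p \<in> carrier F Psort" "x \<in> carrier F Osort" "y \<in> carrier F Osort" "z \<in> carrier F Osort"
    then have l: "linear (induced F {p, x, y, z})"
      using fin[of "{p, x, y, z}"] by (simp add: carrier_def)
    note cs = c[OF a(1), of p x y z] c[OF a(2), of p x y z] c[OF a(3), of p x y z] c[OF a(4), of p x y z]
    show "less F p x y \<Longrightarrow> less F p y z \<Longrightarrow> less F p x z"
      using linear_trans[OF l cs] by simp
  next
    fix p x y
    assume a: "p \<in> carrier F Psort" "x \<in> carrier F Osort" "y \<in> carrier F Osort"
    then have l: "linear (induced F {p, x, y, y})"
      using fin[of "{p, x, y, y}"] by (simp add: carrier_def)
    note cs = c[OF a(1), of p x y y] c[OF a(2), of p x y y] c[OF a(3), of p x y y]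
    show "x \<noteq> y \<Longrightarrow> less F p x y \<or> less F p y x"
      using linear_total[OF l cs] by simp
  next
    fix p x
    assume a: "p \<in> carrier F Psort" "x \<in> carrier F Osort"
    then have l: "linear (induced F {p, x, x, x})"
      using fin[of "{p, x, x, x}"] by (simp add: carrier_def)
    show "\<not> less F p x x"
      using linear_irrefl[OF l c[OF a(1), of p x x x] c[OF a(2), of p x x x]] by simp
  qed
qed

text \<open>The indices 3, 2, 1, 0 stand for \<open>p\<close>, \<open>x\<close>, \<open>y\<close>,
  \<open>z\<close>. The sentence denies a failure of irreflexivity at \<open>x\<close>, of totality
  at \<open>x\<close>, \<open>y\<close> or of transitivity at \<open>x\<close>, \<open>y\<close>,
  \<open>z\<close>.\<close>

definition linear_fm :: fm where
  "linear_fm = Neg (Ex Psort (Ex Osort (Ex Osort (Ex Osort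
     (Neg (Conj (Neg (Less 3 2 2))
       (Conj (Neg (Conj (Neg (Eq 2 1)) (Conj (Neg (Less 3 2 1)) (Neg (Less 3 1 2)))))
         (Neg (Conj (Less 3 2 1) (Conj (Less 3 1 0) (Neg (Less 3 2 0)))))))))))) "

lemma sat_linear_fm: "sat N [] linear_fm \<longleftrightarrow> linear N"
proof -
  have s: "\<And>a b c d. [a, b, c, d] ! Suc 0 = b" "\<And>a b c d. [a, b, c, d] ! 2 = c" "\<And>a b c d. [a, b, c, d] ! 3 = d"
    by (simp_all add: numeral_2_eq_2 numeral_3_eq_3)
  show ?thesis
    unfolding linear_fm_def linear_def lin_on_def by (simp add: s) blast
qed

lemma wf_linear_fm: "wf_fm [] linear_fm"
  by (simp add: linear_fm_def numeral_2_eq_2 numeral_3_eq_3)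

section \<open>Models of \<open>DLOp\<close>: extension of finite embeddings and quantifier
  elimination\<close>

locale DLOp_model =
  fixes N :: "'a struc"
  assumes models: "models N DLOp"
begin

lemma axiom: "wf_fm [] \<phi> \<Longrightarrow> (\<And>F. fraisse_limit DLOp_class F \<Longrightarrow> sat F [] \<phi>) \<Longrightarrow> sat N [] \<phi>"
  using models unfolding models_def DLOp_def Th_def by auto

lemma linear: "linear N"
  using axiom[OF wf_linear_fm] limit_linear by (auto simp: sat_linear_fm)

lemma one_point_extension:
  fixes E :: "'b struc"
  assumes E: "linear E" "set (x # c) \<subseteq> univ E" and g: "embedding g (induced E (set c)) N"
  obtains g' where "embedding g' (induced E (set (x # c))) N" "\<And>a. a \<in> set c \<Longrightarrow> g' a = g a"
proof -
  \<comment> \<open>The extension axiom of \<open>x\<close> over \<open>c\<close>. Being a sentence,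
    it carries the property from the limit to \<open>N\<close>, whatever the element type of
    \<open>E\<close> is.\<close>
  let ?\<phi> = "Neg (exs (sorts E c) (Conj (diag E c) (Neg (Ex (sort E x) (diag E (x # c))))))"
  have "wf_fm (sort E x # sorts E c) (diag E (x # c))"
    using wf_diag[of E "x # c"] by (simp add: sorts_def)
  then have "wf_fm [] ?\<phi>"
    using wf_diag[of E c] by (simp add: wf_exs)
  then have "sat N [] ?\<phi>"
    by (rule axiom) (use limit_extension[OF _ E] in \<open>auto simp: sat_exs\<close>)
  moreover have gc: "map g c \<in> tuples N (sorts E c)"
    using g by (auto simp: tuples_def sorts_def embedding_induced_iff)
  moreover note sat_diag_embedding[OF g]
  ultimately obtain y where y: "y \<in> carrier N (sort E x)" "sat N (y # map g c) (diag E (x # c))"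
    by (auto simp: sat_exs)
  have "y # map g c \<in> tuples N (sorts E (x # c))"
    using gc y(1) by (auto simp: tuples_def sorts_def carrier_def)
  then obtain g' where "embedding g' (induced E (set (x # c))) N" "map g' (x # c) = y # map g c"
    using embedding_of_diag[OF _ y(2)] by blast
  then show thesis
    using that by auto
qed

text \<open>Induction on the points to be added. Together with linearity, this is the form in which
  the axioms are used from here on.\<close>

lemma embedding_extension:
  fixes E :: "'b struc"
  assumes E: "linear E" and S: "finite S" "S \<subseteq> univ E" "C \<subseteq> S"
    and g: "embedding g (induced E C) N"
  obtains g' where "embedding g' (induced E S) N" "\<And>a. a \<in> C \<Longrightarrow> g' a = g a"
proof -
  have fin: "finite (S - C)" "finite C"
    using S by (auto intro: finite_subset)
  have "\<exists>g'. embedding g' (induced E (C \<union> T)) N \<and> (\<forall>a\<in>C. g' a = g a)" if "T \<subseteq> S - C" for T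
    using finite_subset[OF that fin(1)] that
  proof (induction T rule: finite_induct)
    case empty
    then show ?case using g by auto
  next
    case (insert x T)
    then obtain g1 where g1: "embedding g1 (induced E (C \<union> T)) N" "\<forall>a\<in>C. g1 a = g a"
      by auto
    obtain c where c: "set c = C \<union> T"
      using insert fin finite_list[of "C \<union> T"] by auto
    have "set (x # c) \<subseteq> univ E"
      using insert S c by auto
    from one_point_extension[OF E this, unfolded c, OF g1(1)]
    obtain g2 where "embedding g2 (induced E (set (x # c))) N" "\<And>a. a \<in> C \<union> T \<Longrightarrow> g2 a = g1 a"
      by metis
    then show ?case
      using g1(2) c by (intro exI[of _ g2]) auto
  qed
  from this[of "S - C"] obtain g' where "embedding g' (induced E S) N" "\<forall>a\<in>C. g' a = g a"
    using S(3) by (auto simp: Un_absorb1)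
  then show thesis
    using that by blast
qed

text \<open>Quantifier elimination in back-and-forth form: in the case of \<open>Ex\<close>, a
  finite partial embedding extends to a witness.\<close>

lemma sat_embedding:
  assumes "embedding g (induced N (set e)) N" "set e \<subseteq> univ N" "wf_fm (sorts N e) \<phi>"
  shows "sat N (map g e) \<phi> \<longleftrightarrow> sat N e \<phi>"
  using assms
proof (induction \<phi> arbitrary: e g)
  case (Eq i j)
  then show ?case by (auto simp: embedding_induced_iff sorts_def inj_on_eq_iff)
next
  case (Less i j k)
  then show ?case by (auto simp: embedding_induced_iff sorts_def)
next
  case (Ex s \<phi>)
  \<comment> \<open>One direction, for every partial embedding \<open>h\<close>. The other direction
    is the same statement for the inverse of \<open>g\<close>.\<close>
  have step: "sat N (map h d) (Ex s \<phi>)"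
    if h: "embedding h (induced N (set d)) N" and d: "set d \<subseteq> univ N" "sorts N d = sorts N e"
      and sd: "sat N d (Ex s \<phi>)" for h d
  proof -
    from sd obtain a where a: "a \<in> carrier N s" "sat N (a # d) \<phi>"
      by auto
    have ad: "set (a # d) \<subseteq> univ N"
      using a(1) d(1) by (auto simp: carrier_def)
    obtain h' where h': "embedding h' (induced N (set (a # d))) N" "\<And>x. x \<in> set d \<Longrightarrow> h' x = h x"
      by (rule embedding_extension[OF linear finite_set ad set_subset_Cons h]) blast
    have "wf_fm (sorts N (a # d)) \<phi>"
      using Ex.prems(3) a(1) d(2) by (simp add: sorts_def carrier_def)
    then have "sat N (map h' (a # d)) \<phi>"
      using Ex.IH[OF h'(1) ad] a(2) by blast
    moreover have "map h' d = map h d"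
      using h'(2) by auto
    moreover have "h' a \<in> carrier N s"
      using h'(1) a(1) by (auto simp: embedding_induced_iff carrier_def)
    ultimately show ?thesis by auto
  qed
  let ?h = "inv_into (set e) g"
  have inj: "inj_on g (set e)"
    using Ex.prems(1) by (auto simp: embedding_induced_iff)
  have "embedding ?h (induced N (set (map g e))) N"
    using embedding_inv[OF Ex.prems(1,2)] by simp
  moreover have "map ?h (map g e) = e"
    using inj by (auto intro: map_idI)
  moreover have "set (map g e) \<subseteq> univ N" "sorts N (map g e) = sorts N e"
    using Ex.prems(1) by (auto simp: embedding_induced_iff sorts_def)
  ultimately show ?case
    using step[OF Ex.prems(1,2)] step[of ?h "map g e"] by metis
qed auto

end

section \<open>Global types from linear extensions\<close>

text \<open>Each \<open><\<^sub>p\<close> joins a linear order on \<open>A\<close> and one on \<open>X\<close>; a relation \<open>G p\<close> that is closed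
  downwards in \<open>A\<close> and upwards in \<open>X\<close> is what makes the result linear.\<close>

definition glue :: "'a set \<Rightarrow> 'b set \<Rightarrow> ('a \<Rightarrow> srt) \<Rightarrow> ('b \<Rightarrow> srt) \<Rightarrow> ('a + 'b \<Rightarrow> 'a \<Rightarrow> 'a \<Rightarrow> bool) \<Rightarrow>
    ('a + 'b \<Rightarrow> 'b \<Rightarrow> 'b \<Rightarrow> bool) \<Rightarrow> ('a + 'b \<Rightarrow> 'a \<Rightarrow> 'b \<Rightarrow> bool) \<Rightarrow> ('a + 'b) struc" where
  "glue A X sA sX rA rX G =
     \<lparr>univ = A <+> X, sort = case_sum sA sX,
      less = (\<lambda>p. case_sum (\<lambda>y. case_sum (rA p y) (G p y)) (\<lambda>x. case_sum (\<lambda>y. \<not> G p y x) (rX p x)))\<rparr>"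

lemma glue_simps [simp]:
  "univ (glue A X sA sX rA rX G) = A <+> X"
  "sort (glue A X sA sX rA rX G) (Inl y) = sA y"
  "sort (glue A X sA sX rA rX G) (Inr x) = sX x"
  "less (glue A X sA sX rA rX G) p (Inl y) (Inl z) = rA p y z"
  "less (glue A X sA sX rA rX G) p (Inl y) (Inr x) = G p y x"
  "less (glue A X sA sX rA rX G) p (Inr x) (Inl y) = (\<not> G p y x)"
  "less (glue A X sA sX rA rX G) p (Inr x) (Inr w) = rX p x w"
  by (simp_all add: glue_def)

lemma lin_on_glue:
  assumes A: "lin_on A rA" and X: "lin_on X rX"
    and down: "\<And>y z x. y \<in> A \<Longrightarrow> z \<in> A \<Longrightarrow> x \<in> X \<Longrightarrow> rA z y \<Longrightarrow> G y x \<Longrightarrow> G z x"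
    and up: "\<And>y x w. y \<in> A \<Longrightarrow> x \<in> X \<Longrightarrow> w \<in> X \<Longrightarrow> rX x w \<Longrightarrow> G y x \<Longrightarrow> G y w"
    and R: "\<And>y z. R (Inl y) (Inl z) = rA y z" "\<And>y x. R (Inl y) (Inr x) = G y x"
      "\<And>y x. R (Inr x) (Inl y) = (\<not> G y x)" "\<And>x w. R (Inr x) (Inr w) = rX x w"
  shows "lin_on (A <+> X) R"
proof -
  show ?thesis
  proof (rule lin_onI)
    fix u v w assume *: "u \<in> A <+> X" "v \<in> A <+> X" "w \<in> A <+> X" "R u v" "R v w"
    note A' = lin_on_total[OF A] lin_on_trans[OF A] and X' = lin_on_total[OF X] lin_on_trans[OF X]
    \<comment> \<open>The eight cases are the possible sides of \<open>u\<close>, \<open>v\<close>,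
      \<open>w\<close>. Totality is needed where \<open>u\<close> and \<open>w\<close> lie on one
      side and \<open>v\<close> on the other: the reverse order of \<open>u\<close> and
      \<open>w\<close> would contradict \<open>down\<close> or \<open>up\<close>.\<close>
    from * show "R u w"
      apply (elim PlusE)
             apply (simp_all only: R)
             apply (blast intro: A' down up)
            apply (blast intro: down)
           apply (metis A'(1) down)
          apply (blast intro: up)
         apply (blast intro: down)
        apply (metis X'(1) up)
       apply (blast intro: up)
      apply (blast intro: X')
      done
  next
    fix u v assume "u \<in> A <+> X" "v \<in> A <+> X" "u \<noteq> v"
    then show "R u v \<or> R v u"
      using lin_on_total[OF A] lin_on_total[OF X] by (elim PlusE) (auto simp: R)
  next
    fix u assume "u \<in> A <+> X"
    then show "\<not> R u u"
      using lin_on_irrefl[OF A] lin_on_irrefl[OF X] by (elim PlusE) (auto simp: R)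
  qed
qed

lemma linear_glue:
  assumes A: "\<And>p. p \<in> carrier (glue A X sA sX rA rX G) Psort \<Longrightarrow> lin_on {y \<in> A. sA y = Osort} (rA p)"
    and X: "\<And>p. p \<in> carrier (glue A X sA sX rA rX G) Psort \<Longrightarrow> lin_on {x \<in> X. sX x = Osort} (rX p)"
    and down: "\<And>p y z x. p \<in> carrier (glue A X sA sX rA rX G) Psort \<Longrightarrow>
      y \<in> A \<Longrightarrow> sA y = Osort \<Longrightarrow> z \<in> A \<Longrightarrow> sA z = Osort \<Longrightarrow> x \<in> X \<Longrightarrow> sX x = Osort \<Longrightarrow>
      rA p z y \<Longrightarrow> G p y x \<Longrightarrow> G p z x"
    and up: "\<And>p y x w. p \<in> carrier (glue A X sA sX rA rX G) Psort \<Longrightarrow>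
      y \<in> A \<Longrightarrow> sA y = Osort \<Longrightarrow> x \<in> X \<Longrightarrow> sX x = Osort \<Longrightarrow> w \<in> X \<Longrightarrow> sX w = Osort \<Longrightarrow>
      rX p x w \<Longrightarrow> G p y x \<Longrightarrow> G p y w"
  shows "linear (glue A X sA sX rA rX G)"
proof -
  have c: "carrier (glue A X sA sX rA rX G) Osort = {y \<in> A. sA y = Osort} <+> {x \<in> X. sX x = Osort}"
    by (auto simp: carrier_def)
  show ?thesis
    unfolding linear_def
  proof
    fix p assume p: "p \<in> carrier (glue A X sA sX rA rX G) Psort"
    show "lin_on (carrier (glue A X sA sX rA rX G) Osort) (less (glue A X sA sX rA rX G) p)"
      unfolding c by (rule lin_on_glue[OF A[OF p] X[OF p]]) (auto intro: down[OF p] up[OF p])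
  qed
qed

lemma carrier_glue_Psort:
  "p \<in> carrier (glue A X sA sX rA rX G) Psort \<longleftrightarrow>
     (\<exists>y\<in>A. sA y = Psort \<and> p = Inl y) \<or> (\<exists>x\<in>X. sX x = Psort \<and> p = Inr x)"
  by (auto simp: carrier_def)

section \<open>New points in prescribed positions\<close>

context DLOp_model
begin

abbreviation O_N where "O_N \<equiv> carrier N Osort"
abbreviation P_N where "P_N \<equiv> carrier N Psort"

lemma lin: "p \<in> P_N \<Longrightarrow> lin_on O_N (less N p)"
  using linear by (simp add: linear_def)

text \<open>One point is glued to \<open>S\<close> and the result is copied back into
  \<open>N\<close> over \<open>S\<close>. Different orders are unrelated, so a point of sort
  \<open>O\<close> can be put immediately to the right of an arbitrary \<open>e p\<close>, in or
  outside of \<open>S\<close>, separately for each \<open>p\<close>.\<close>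

lemma new_element:
  assumes S: "finite S" "S \<subseteq> univ N" and c: "c \<in> univ N"
    and e: "\<And>p. p \<in> P_N \<Longrightarrow> sort N c = Osort \<Longrightarrow> e p \<in> O_N"
  obtains c' where "c' \<in> univ N" "sort N c' = sort N c" "c' \<notin> S"
    "\<And>y z. sort N c = Psort \<Longrightarrow> y \<in> S \<Longrightarrow> z \<in> S \<Longrightarrow> sort N y = Osort \<Longrightarrow> sort N z = Osort \<Longrightarrow>
       less N c' y z \<longleftrightarrow> less N c y z"
    "\<And>p y. sort N c = Osort \<Longrightarrow> p \<in> S \<Longrightarrow> y \<in> S \<Longrightarrow> sort N p = Psort \<Longrightarrow> sort N y = Osort \<Longrightarrow>
       less N p y c' \<longleftrightarrow> y = e p \<or> less N p y (e p)"
    "\<And>p y. sort N c = Osort \<Longrightarrow> p \<in> S \<Longrightarrow> y \<in> S \<Longrightarrow> sort N p = Psort \<Longrightarrow> sort N y = Osort \<Longrightarrow>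
       less N p c' y \<longleftrightarrow> less N p (e p) y"
proof -
  define E where "E = glue S {()} (sort N) (\<lambda>_. sort N c) (case_sum (less N) (\<lambda>_. less N c))
    (\<lambda>_ _ _. False) (case_sum (\<lambda>p y _. y = e p \<or> less N p y (e p)) (\<lambda>_ _ _. False))"
  have SO: "{y \<in> S. sort N y = Osort} \<subseteq> O_N"
    using S by (auto simp: carrier_def)
  have E: "linear E"
    unfolding E_def
  proof (rule linear_glue; unfold carrier_glue_Psort)
    fix p :: "'a + unit"
    assume p: "(\<exists>y\<in>S. sort N y = Psort \<and> p = Inl y) \<or> (\<exists>x\<in>{()}. sort N c = Psort \<and> p = Inr x)"
    then show "lin_on {y \<in> S. sort N y = Osort} (case_sum (less N) (\<lambda>_. less N c) p)"
      using subsetD[OF S(2)] c by (auto intro!: lin_on_mono[OF lin SO] simp: carrier_def)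
    show "lin_on {x \<in> {()}. sort N c = Osort} (\<lambda>_ _. False)"
      by (auto simp: lin_on_def)
    fix y z x assume "y \<in> S" "sort N y = Osort" "z \<in> S" "sort N z = Osort" "sort N c = Osort"
      "case_sum (less N) (\<lambda>_. less N c) p z y"
      "case_sum (\<lambda>p y _. y = e p \<or> less N p y (e p)) (\<lambda>_ _ _. False) p y x"
    moreover have "y \<in> O_N" "z \<in> O_N"
      using calculation S(2) by (auto simp: carrier_def)
    moreover have "q \<in> P_N" if "q \<in> S" "sort N q = Psort" for q
      using that S(2) by (auto simp: carrier_def)
    ultimately show "case_sum (\<lambda>p y _. y = e p \<or> less N p y (e p)) (\<lambda>_ _ _. False) p z x"
      using p e lin_on_trans[OF lin, of "projl p" z y "e (projl p)"] by (cases p) auto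
  qed auto
  have inv: "embedding (inv_into S Inl) (induced E (Inl ` S)) N"
    by (rule embedding_inv) (use S in \<open>auto simp: E_def embedding_induced_iff\<close>)
  have fin: "finite (univ E)" "Inl ` S \<subseteq> univ E"
    using S by (auto simp: E_def)
  obtain f where f: "embedding f (induced E (univ E)) N"
    and fI: "\<And>a. a \<in> Inl ` S \<Longrightarrow> f a = inv_into S Inl a"
    by (rule embedding_extension[OF E fin(1) subset_refl fin(2) inv]) blast
  have fI: "f (Inl y) = y" if "y \<in> S" for y
    using fI that by simp
  have u: "Inr () \<in> univ E" "\<And>y. y \<in> S \<Longrightarrow> Inl y \<in> univ E"
    by (auto simp: E_def)
  have inj: "f (Inr ()) \<noteq> f (Inl y)" if "y \<in> S" for y
    using embedding_eq_iff[OF f u(1) u(2)[OF that]] by simp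
  note fl = embedding_less[OF f]
  show thesis
  proof
    show "f (Inr ()) \<in> univ N" "sort N (f (Inr ())) = sort N c"
      using f u(1) by (auto simp: embedding_induced_iff E_def)
    show "f (Inr ()) \<notin> S"
      using inj fI by metis
    show "less N (f (Inr ())) y z \<longleftrightarrow> less N c y z" if "sort N c = Psort" "y \<in> S" "z \<in> S"
      "sort N y = Osort" "sort N z = Osort" for y z
      using fl[of "Inr ()" "Inl y" "Inl z"] u fI that by (simp add: E_def)
    show "less N p y (f (Inr ())) \<longleftrightarrow> y = e p \<or> less N p y (e p)" if "sort N c = Osort" "p \<in> S" "y \<in> S"
      "sort N p = Psort" "sort N y = Osort" for p y
      using fl[of "Inl p" "Inl y" "Inr ()"] u fI that by (simp add: E_def)
    show "less N p (f (Inr ())) y \<longleftrightarrow> less N p (e p) y" if "sort N c = Osort" "p \<in> S" "y \<in> S"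
      "sort N p = Psort" "sort N y = Osort" for p y
    proof -
      have py: "p \<in> P_N" "y \<in> O_N" "e p \<in> O_N"
        using that S(2) e by (auto simp: carrier_def)
      have "less N p (f (Inr ())) y \<longleftrightarrow> \<not> (y = e p \<or> less N p y (e p))"
        using fl[of "Inl p" "Inr ()" "Inl y"] u fI that by (simp add: E_def)
      also have "\<dots> \<longleftrightarrow> less N p (e p) y"
        using lin_on_total[OF lin] lin_on_irrefl[OF lin] lin_on_asym[OF lin] py by metis
      finally show ?thesis .
    qed
  qed
qed

end

section \<open>The global type of a tuple in a linear extension\<close>

lemma sorts_map_embedding:
  "embedding f (induced A S) B \<Longrightarrow> set e \<subseteq> S \<Longrightarrow> sorts B (map f e) = sorts A e"
  by (auto simp: embedding_induced_iff sorts_def)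

locale DLOp_extension = DLOp_model N for N :: "'a struc" +
  fixes L :: "'b struc" and \<iota> :: "'a \<Rightarrow> 'b" and t :: "'b list"
  assumes linear_L: "linear L" and \<iota>: "embedding \<iota> N L" and t: "set t \<subseteq> univ L"
begin

text \<open>The type of \<open>t\<close> over \<open>N\<close>: the tuple lies in the extension \<open>L\<close>, which is not required to be a model,
  so a formula is evaluated in \<open>N\<close> at any copy of \<open>t\<close> over its parameters.\<close>

definition gtp :: "(fm \<times> 'a list) set" where
  "gtp = {(\<phi>, c) \<in> formulas_over N (univ N) (sorts L t).
     \<exists>f. embedding f (induced L (set t \<union> \<iota> ` set c)) N \<and> (\<forall>y\<in>set c. f (\<iota> y) = y) \<and> sat N (map f t @ c) \<phi>}"

lemma \<iota>_induced: "C \<subseteq> univ N \<Longrightarrow> embedding \<iota> (induced N C) L"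
  using embedding_mono[of \<iota> N "univ N" L C] \<iota> by (simp add: induced_def)

text \<open>\<open>embedding_extension\<close> applied to the inverse of \<open>\<iota>\<close> on
  the parameters: finite parts of \<open>L\<close> have copies in \<open>N\<close> over any finite
  set of parameters.\<close>

lemma realization:
  assumes "finite C" "C \<subseteq> univ N"
  obtains f where "embedding f (induced L (set t \<union> \<iota> ` C)) N" "\<And>y. y \<in> C \<Longrightarrow> f (\<iota> y) = y"
proof -
  have i: "embedding \<iota> (induced N C) L"
    using assms(2) by (rule \<iota>_induced)
  have inv: "embedding (inv_into C \<iota>) (induced L (\<iota> ` C)) N"
    using i assms(2) by (rule embedding_inv)
  have S: "finite (set t \<union> \<iota> ` C)" "set t \<union> \<iota> ` C \<subseteq> univ L"
    using i t assms(1) by (auto simp: embedding_induced_iff)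
  obtain f where "embedding f (induced L (set t \<union> \<iota> ` C)) N"
    "\<And>a. a \<in> \<iota> ` C \<Longrightarrow> f a = inv_into C \<iota> a"
    by (rule embedding_extension[OF linear_L S Un_upper2 inv]) blast
  moreover have "inj_on \<iota> C"
    using i by (simp add: embedding_induced_iff)
  ultimately show thesis
    using that by simp
qed

text \<open>The composition of \<open>g\<close> with the inverse of \<open>f\<close> is a finite
  partial embedding of \<open>N\<close>, so it preserves formulas. Hence \<open>gtp\<close> does not
  depend on the chosen copy of \<open>t\<close>.\<close>

lemma sat_two_embeddings:
  assumes c: "set c \<subseteq> univ N" and wf: "wf_fm (sorts L t @ sorts N c) \<phi>"
    and f: "embedding f (induced L (set t \<union> \<iota> ` set c)) N"
    and g: "embedding g (induced L (set t \<union> \<iota> ` set c)) N"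
  shows "sat N (map f t @ map (f \<circ> \<iota>) c) \<phi> \<longleftrightarrow> sat N (map g t @ map (g \<circ> \<iota>) c) \<phi>"
proof -
  let ?S = "set t \<union> \<iota> ` set c" and ?e = "t @ map \<iota> c"
  have S: "?S \<subseteq> univ L"
    using t \<iota>_induced[OF c] by (auto simp: embedding_induced_iff)
  have e: "set ?e = ?S"
    by simp
  have inv: "embedding (inv_into ?S f) (induced N (f ` ?S)) L"
    by (rule embedding_inv[OF f S])
  have k: "embedding (g \<circ> inv_into ?S f) (induced N (set (map f ?e))) N"
  proof -
    have "set (map f ?e) = f ` ?S"
      by auto
    moreover have "inv_into ?S f ` f ` ?S \<subseteq> ?S"
      by (rule image_subsetI) (rule inv_into_into)
    ultimately show ?thesis
      using embedding_comp[OF inv g] by simp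
  qed
  have "sorts N (map f ?e) = sorts L ?e"
    using sorts_map_embedding[OF f, of ?e] e by blast
  also have "\<dots> = sorts L t @ sorts N c"
    using \<iota>_induced[OF c] by (auto simp: sorts_def embedding_induced_iff)
  finally have "sat N (map (g \<circ> inv_into ?S f) (map f ?e)) \<phi> \<longleftrightarrow> sat N (map f ?e) \<phi>"
    using f wf by (intro sat_embedding[OF k]) (auto simp: embedding_induced_iff)
  moreover have "map (g \<circ> inv_into ?S f) (map f ?e) = map g ?e"
  proof -
    have "inv_into ?S f (f x) = x" if "x \<in> ?S" for x
      using f that by (simp add: embedding_induced_iff)
    then show ?thesis
      by simp
  qed
  ultimately have "sat N (map g ?e) \<phi> \<longleftrightarrow> sat N (map f ?e) \<phi>"
    by (simp only:)
  then show ?thesis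
    by simp
qed

text \<open>Here the copy may move the parameters as well, in contrast to the definition of
  \<open>gtp\<close>; this is what the proof of invariance uses.\<close>

lemma gtp_iff:
  assumes c: "set c \<subseteq> univ N" and wf: "wf_fm (sorts L t @ sorts N c) \<phi>"
    and f: "embedding f (induced L (set t \<union> \<iota> ` set c)) N"
  shows "(\<phi>, c) \<in> gtp \<longleftrightarrow> sat N (map f t @ map (f \<circ> \<iota>) c) \<phi>"
proof -
  obtain g where g: "embedding g (induced L (set t \<union> \<iota> ` set c)) N" "\<And>y. y \<in> set c \<Longrightarrow> g (\<iota> y) = y"
    by (rule realization[OF finite_set c]) blast
  have id: "map (h \<circ> \<iota>) c = c" if "\<forall>y\<in>set c. h (\<iota> y) = y" for h
    using that by (auto intro: map_idI)
  have "(\<phi>, c) \<in> gtp \<longleftrightarrow> sat N (map g t @ map (g \<circ> \<iota>) c) \<phi>"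
  proof
    assume "(\<phi>, c) \<in> gtp"
    then obtain h where "embedding h (induced L (set t \<union> \<iota> ` set c)) N" "\<forall>y\<in>set c. h (\<iota> y) = y"
      "sat N (map h t @ c) \<phi>"
      by (auto simp: gtp_def)
    then show "sat N (map g t @ map (g \<circ> \<iota>) c) \<phi>"
      using sat_two_embeddings[OF c wf _ g(1), of h] id by simp
  next
    assume "sat N (map g t @ map (g \<circ> \<iota>) c) \<phi>"
    then show "(\<phi>, c) \<in> gtp"
      using g id[of g] c wf by (auto simp: gtp_def formulas_over_def)
  qed
  then show ?thesis
    using sat_two_embeddings[OF c wf f g(1)] by simp
qed

lemma global_gtp: "global_type N (sorts L t) gtp"
  unfolding global_type_def
proof (intro conjI)
  show "gtp \<subseteq> formulas_over N (univ N) (sorts L t)"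
    by (auto simp: gtp_def)
  show "consistent N (sorts L t) gtp"
    unfolding consistent_def
  proof (intro allI impI)
    fix p0 assume p0: "finite p0 \<and> p0 \<subseteq> gtp"
    \<comment> \<open>A single copy of \<open>t\<close> over all parameters of \<open>p0\<close>
      satisfies all its formulas at once.\<close>
    let ?C = "\<Union>(\<phi>, c)\<in>p0. set c"
    have "finite ?C" "?C \<subseteq> univ N"
      using p0 by (auto simp: gtp_def formulas_over_def)
    then obtain f where f: "embedding f (induced L (set t \<union> \<iota> ` ?C)) N" "\<And>y. y \<in> ?C \<Longrightarrow> f (\<iota> y) = y"
      by (rule realization) blast
    have "sat N (map f t @ c) \<phi>" if *: "(\<phi>, c) \<in> p0" for \<phi> c
    proof -
      have "embedding f (induced L (set t \<union> \<iota> ` set c)) N"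
        by (rule embedding_mono[OF f(1)]) (use * in auto)
      moreover have g: "(\<phi>, c) \<in> gtp"
        using * p0 by blast
      moreover from g have "set c \<subseteq> univ N" "wf_fm (sorts L t @ sorts N c) \<phi>"
        by (auto simp: gtp_def formulas_over_def)
      moreover have "map (f \<circ> \<iota>) c = c"
        using f(2) * by (intro map_idI) auto
      ultimately show ?thesis
        using gtp_iff by metis
    qed
    moreover have "map f t \<in> tuples N (sorts L t)"
      using f(1) by (auto simp: tuples_def sorts_def embedding_induced_iff)
    ultimately show "\<exists>a\<in>tuples N (sorts L t). realizes N a p0"
      by (auto simp: realizes_def)
  qed
  show "\<forall>(\<phi>, c)\<in>formulas_over N (univ N) (sorts L t). (\<phi>, c) \<in> gtp \<or> (Neg \<phi>, c) \<in> gtp"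
  proof safe
    fix \<phi> c assume *: "(\<phi>, c) \<in> formulas_over N (univ N) (sorts L t)" "(Neg \<phi>, c) \<notin> gtp"
    then have c: "set c \<subseteq> univ N" "wf_fm (sorts L t @ sorts N c) \<phi>"
      by (auto simp: formulas_over_def)
    obtain f where "embedding f (induced L (set t \<union> \<iota> ` set c)) N"
      by (rule realization[OF finite_set c(1)])
    then show "(\<phi>, c) \<in> gtp"
      using gtp_iff[OF c] gtp_iff[OF c(1), of "Neg \<phi>"] c(2) *(2) by simp
  qed
qed

text \<open>A copy \<open>f\<close> of \<open>t\<close> over \<open>c'\<close>, composed with the
  partial embedding \<open>h\<close>, is a copy over \<open>c\<close> at which the formula takes the
  same value.\<close>

lemma invariant_gtp:
  assumes "\<And>c c'. set c \<subseteq> univ N \<Longrightarrow> set c' \<subseteq> univ N \<Longrightarrow> equiv_over N M c c' \<Longrightarrow>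
    \<exists>h. embedding h (induced L (set t \<union> \<iota> ` set c)) L \<and> (\<forall>x\<in>set t. h x = x) \<and> map (h \<circ> \<iota>) c = map \<iota> c'"
  shows "invariant_type N M (sorts L t) gtp"
  unfolding invariant_type_def
proof (intro conjI global_gtp allI impI)
  fix \<phi> c c'
  assume *: "set c \<subseteq> univ N \<and> set c' \<subseteq> univ N \<and> wf_fm (sorts L t @ sorts N c) \<phi> \<and> equiv_over N M c c'"
  then obtain h where h: "embedding h (induced L (set t \<union> \<iota> ` set c)) L" "\<forall>x\<in>set t. h x = x"
    "map (h \<circ> \<iota>) c = map \<iota> c'"
    using assms by blast
  obtain f where f: "embedding f (induced L (set t \<union> \<iota> ` set c')) N"
    by (rule realization[of "set c'"]) (use * in auto)
  have "h ` \<iota> ` set c = \<iota> ` set c'"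
    using arg_cong[OF h(3), of set] by (simp add: image_comp)
  then have fh: "embedding (f \<circ> h) (induced L (set t \<union> \<iota> ` set c)) N"
    using h(2) by (intro embedding_comp[OF h(1) f]) auto
  have so: "sorts N c' = sorts N c"
    using * by (simp add: equiv_over_def)
  have "map (f \<circ> h) t = map f t"
    using h(2) by simp
  moreover have "map (f \<circ> h \<circ> \<iota>) c = map (f \<circ> \<iota>) c'"
    using arg_cong[OF h(3), of "map f"] by (simp add: comp_assoc)
  moreover have "(\<phi>, c) \<in> gtp \<longleftrightarrow> sat N (map (f \<circ> h) t @ map (f \<circ> h \<circ> \<iota>) c) \<phi>"
    using gtp_iff[OF _ _ fh, of \<phi>] * by blast
  ultimately have "(\<phi>, c) \<in> gtp \<longleftrightarrow> sat N (map f t @ map (f \<circ> \<iota>) c') \<phi>"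
    by (simp only:)
  then show "(\<phi>, c) \<in> gtp \<longleftrightarrow> (\<phi>, c') \<in> gtp"
    using gtp_iff[OF _ _ f, of \<phi>] * so by simp
qed

end

section \<open>Morley sequences\<close>

lemma equiv_over_sat:
  assumes "equiv_over N M e e'" "set c \<subseteq> M" "wf_fm (sorts N e @ sorts N c) \<phi>"
  shows "sat N (e @ c) \<phi> \<longleftrightarrow> sat N (e' @ c) \<phi>"
proof -
  have "(\<phi>, c) \<in> tp N M e \<longleftrightarrow> (\<phi>, c) \<in> tp N M e'" "sorts N e = sorts N e'"
    using assms(1) by (auto simp: equiv_over_def)
  then show ?thesis
    using assms(2,3) by (simp add: tp_def formulas_over_def)
qed

lemma equiv_overI:
  assumes so: "sorts N e = sorts N e'"
    and s: "\<And>\<phi> c. set c \<subseteq> M \<Longrightarrow> wf_fm (sorts N e @ sorts N c) \<phi> \<Longrightarrow> sat N (e @ c) \<phi> \<Longrightarrow> sat N (e' @ c) \<phi>"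
  shows "equiv_over N M e e'"
proof -
  have "sat N (e @ c) \<phi> \<longleftrightarrow> sat N (e' @ c) \<phi>" if "set c \<subseteq> M" "wf_fm (sorts N e @ sorts N c) \<phi>" for c \<phi>
    using s[OF that] s[of c "Neg \<phi>"] that by auto
  then show ?thesis
    using so by (auto simp: equiv_over_def tp_def formulas_over_def)
qed

lemma equiv_over_sym: "equiv_over N M e e' \<Longrightarrow> equiv_over N M e' e"
  by (simp add: equiv_over_def)

lemma equiv_over_trans: "equiv_over N M e e' \<Longrightarrow> equiv_over N M e' e'' \<Longrightarrow> equiv_over N M e e''"
  by (simp add: equiv_over_def)

text \<open>For every finite \<open>m\<close> from \<open>M\<close>, the diagram of
  \<open>c @ m\<close> belongs to the type of \<open>c\<close> over \<open>M\<close> and yields an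
  embedding \<open>K m\<close>. These maps agree on \<open>c\<close> and fix \<open>M\<close>, so
  they have a common extension.\<close>

lemma equiv_over_embedding:
  assumes e: "equiv_over N M c c'" and c: "set c \<subseteq> univ N" "set c' \<subseteq> univ N" and M: "M \<subseteq> univ N"
  obtains k where "embedding k (induced N (set c \<union> M)) N" "map k c = c'" "\<And>m. m \<in> M \<Longrightarrow> k m = m"
proof -
  have ex: "\<exists>k. embedding k (induced N (set (c @ m))) N \<and> map k (c @ m) = c' @ m" if "set m \<subseteq> M" for m
  proof -
    have "sat N (c @ m) (diag N (c @ m))"
      using sat_diag_embedding[of id N "c @ m" N] c(1) M that by (auto simp: embedding_induced_iff)
    moreover have "wf_fm (sorts N c @ sorts N m) (diag N (c @ m))"
      using wf_diag[of N "c @ m"] by (simp add: sorts_def)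
    ultimately have "sat N (c' @ m) (diag N (c @ m))"
      using equiv_over_sat[OF e that] by blast
    moreover have "c' @ m \<in> tuples N (sorts N (c @ m))"
      using c(2) M that e by (auto simp: tuples_def sorts_def equiv_over_def)
    ultimately show ?thesis
      using embedding_of_diag by metis
  qed
  then obtain K where K: "\<And>m. set m \<subseteq> M \<Longrightarrow> embedding (K m) (induced N (set (c @ m))) N"
      "\<And>m. set m \<subseteq> M \<Longrightarrow> map (K m) (c @ m) = c' @ m"
    by metis
  have len: "length c' = length c"
    using e by (auto simp: equiv_over_def sorts_def dest: map_eq_imp_length_eq)
  have Kc: "map (K m) c = c'" and Km: "x \<in> set m \<Longrightarrow> K m x = x" if "set m \<subseteq> M" for m x
  proof -
    have "map (K m) c = c'" "map (K m) m = m"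
      using K(2)[OF that] len by auto
    then show "map (K m) c = c'" "x \<in> set m \<Longrightarrow> K m x = x"
      by (auto simp: map_idI dest: map_eq_conv[THEN iffD1, of _ _ id, simplified])
  qed
  have Keq: "K m x = K m' x" if "x \<in> set c" "set m \<subseteq> M" "set m' \<subseteq> M" for x m m'
    using Kc[OF that(2)] Kc[OF that(3)] that(1) by (metis map_eq_conv)
  define k where "k x = (if x \<in> M then x else K [] x)" for x
  have kK: "k x = K m x" if "set m \<subseteq> M" "x \<in> set (c @ m)" for x m
  proof (cases "x \<in> M")
    case True
    then have "K m x = x"
      using that Km[of m x] Km[of "[x]" x] Keq[of x m "[x]"] by auto
    then show ?thesis using True by (simp add: k_def)
  next
    case False
    then show ?thesis
      using that Keq[of x m "[]"] by (auto simp: k_def)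
  qed
  \<comment> \<open>The conditions on an embedding concern at most three elements at a time, and any
    three lie in the domain of one \<open>K m\<close>.\<close>
  have k3: "embedding k (induced N {x, y, z}) N" if "x \<in> set c \<union> M" "y \<in> set c \<union> M" "z \<in> set c \<union> M" for x y z
  proof -
    define m where "m = filter (\<lambda>w. w \<in> M) [x, y, z]"
    have m: "set m \<subseteq> M"
      by (auto simp: m_def)
    have "{x, y, z} \<subseteq> set (c @ m)"
      using that by (auto simp: m_def)
    then show ?thesis
      using embedding_mono[OF embedding_cong[OF K(1)[OF m] kK[OF m]]] by blast
  qed
  have "embedding k (induced N (set c \<union> M)) N"
    unfolding embedding_induced_iff
  proof (intro conjI ballI impI)
    show "inj_on k (set c \<union> M)"
      by (rule inj_onI) (use embedding_eq_iff[OF k3] in blast)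
    show "k ` (set c \<union> M) \<subseteq> univ N"
      using embedding_univ[OF k3] by blast
    show "sort N (k a) = sort N a" if "a \<in> set c \<union> M" for a
      using embedding_sort[OF k3[OF that that that]] by simp
    show "less N (k x) (k y) (k z) = less N x y z" if "x \<in> set c \<union> M" "y \<in> set c \<union> M" "z \<in> set c \<union> M"
      "sort N x = Psort" "sort N y = Osort" "sort N z = Osort" for x y z
      using embedding_less[OF k3[OF that(1-3)], of x y z] that by simp
  qed
  moreover have "map k c = c'"
    using Kc[of "[]"] kK[of "[]"] by (auto simp flip: Kc[of "[]"])
  ultimately show thesis
    using that by (simp add: k_def)
qed

section \<open>Conjugates over \<open>M\<close> in a monster model\<close>

locale DLOp_monster = DLOp_model N for N :: "'a struc" +
  fixes \<kappa> :: "'a rel" and M :: "'a set"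
  assumes monster: "monster DLOp \<kappa> N" and M: "M \<subseteq> univ N" "|M| <o \<kappa>"
begin

lemma Cinfinite_\<kappa>: "Cinfinite \<kappa>"
  using monster cinfinite_mono[OF ordLess_imp_ordLeq natLeq_cinfinite] by (auto simp: monster_def)

lemma small_finite: "finite F \<Longrightarrow> |F| <o \<kappa>"
  by (rule Cfinite_ordLess_Cinfinite[OF _ Cinfinite_\<kappa>])
    (simp add: cfinite_def card_of_card_order_on Field_card_of)

lemma small_Un: "finite F \<Longrightarrow> |M \<union> F| <o \<kappa>"
  using card_of_Un_ordLess_infinite_Field[OF _ _ M(2) small_finite] Cinfinite_\<kappa>
  by (auto simp: cinfinite_def)

lemma saturation:
  assumes "A \<subseteq> univ N" "|A| <o \<kappa>" "p \<subseteq> formulas_over N A \<sigma>" "consistent N \<sigma> p"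
  obtains a where "a \<in> tuples N \<sigma>" "realizes N a p"
  using assms monster unfolding monster_def saturated_def by blast

text \<open>Saturation over \<open>M\<close> and \<open>w\<close>, combined with quantifier
  elimination: a finite part of the type of \<open>t\<close> over \<open>M\<close> mentions a finite
  \<open>C\<close>, and a copy of \<open>t\<close> over \<open>C\<close> satisfies it.\<close>

lemma conjugate:
  assumes t: "set t \<subseteq> univ N" and w: "set w \<subseteq> univ N" "wf_fm (sorts N t @ sorts N w) \<chi>"
    and fin: "\<And>C. finite C \<Longrightarrow> C \<subseteq> M \<Longrightarrow> \<exists>k. embedding k (induced N (set t \<union> C)) N \<and>
       (\<forall>y\<in>C. k y = y) \<and> sat N (map k t @ w) \<chi>"
  obtains t' where "set t' \<subseteq> univ N" "sat N (t' @ w) \<chi>" "equiv_over N M t t'"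
proof -
  let ?p = "insert (\<chi>, w) (tp N M t)"
  have "consistent N (sorts N t) ?p"
    unfolding consistent_def
  proof (intro allI impI)
    fix p0 assume p0: "finite p0 \<and> p0 \<subseteq> ?p"
    let ?C = "\<Union>(\<phi>, c)\<in>p0 - {(\<chi>, w)}. set c"
    have C: "finite ?C" "?C \<subseteq> M"
      using p0 by (auto simp: tp_def formulas_over_def)
    then obtain k where k: "embedding k (induced N (set t \<union> ?C)) N" "\<forall>y\<in>?C. k y = y" "sat N (map k t @ w) \<chi>"
      using fin by blast
    have "sat N (map k t @ c) \<phi>" if "(\<phi>, c) \<in> p0" for \<phi> c
    proof (cases "(\<phi>, c) = (\<chi>, w)")
      case False
      then have "(\<phi>, c) \<in> tp N M t"
        using that p0 by auto
      then have *: "set c \<subseteq> M" "wf_fm (sorts N (t @ c)) \<phi>" "sat N (t @ c) \<phi>"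
        by (auto simp: tp_def formulas_over_def sorts_def)
      have sub: "set c \<subseteq> ?C"
        using that False by blast
      then have e: "embedding k (induced N (set (t @ c))) N"
        by (intro embedding_mono[OF k(1)]) auto
      have "sat N (map k (t @ c)) \<phi>"
        using sat_embedding[OF e _ *(2)] *(1,3) t M(1) by auto
      moreover have "map k c = c"
        using k(2) sub by (intro map_idI) blast
      ultimately show ?thesis by simp
    qed (use k(3) in simp)
    moreover have "map k t \<in> tuples N (sorts N t)"
      using k(1) by (auto simp: tuples_def sorts_def embedding_induced_iff)
    ultimately show "\<exists>a\<in>tuples N (sorts N t). realizes N a p0"
      by (auto simp: realizes_def)
  qed
  moreover have "?p \<subseteq> formulas_over N (M \<union> set w) (sorts N t)"
    using w by (auto simp: tp_def formulas_over_def)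
  moreover have "M \<union> set w \<subseteq> univ N" "|M \<union> set w| <o \<kappa>"
    using w(1) M(1) by (simp_all add: small_Un)
  ultimately obtain t' where t': "t' \<in> tuples N (sorts N t)" "realizes N t' ?p"
    using saturation by metis
  have so: "sorts N t = sorts N t'" "set t' \<subseteq> univ N"
    using t'(1) by (auto simp: tuples_def)
  have "equiv_over N M t t'"
    by (rule equiv_overI[OF so(1)]) (use t'(2) in \<open>auto simp: realizes_def tp_def formulas_over_def\<close>)
  then show thesis
    using that so(2) t'(2) by (auto simp: realizes_def)
qed

text \<open>An element outside of \<open>M\<close> is not definable over \<open>M\<close>: over a
  finite \<open>C\<close> it has a twin, which sits immediately to its right in every order if it is
  of sort \<open>O\<close>, and induces the same order on \<open>C\<close> if it is of sort
  \<open>P\<close>.\<close>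

lemma distinct_conjugate:
  assumes c: "c \<in> univ N" "c \<notin> M"
  obtains c' where "c' \<in> univ N" "c' \<noteq> c" "equiv_over N M [c] [c']"
proof -
  have "\<exists>k. embedding k (induced N (set [c] \<union> C)) N \<and> (\<forall>y\<in>C. k y = y) \<and> sat N (map k [c] @ [c]) (Neg (Eq 0 1))"
    if C: "finite C" "C \<subseteq> M" for C
  proof -
    have S: "finite (insert c C)" "insert c C \<subseteq> univ N"
      using C c(1) M(1) by auto
    obtain c' where c': "c' \<in> univ N" "sort N c' = sort N c" "c' \<notin> insert c C"
      "\<And>y z. sort N c = Psort \<Longrightarrow> y \<in> insert c C \<Longrightarrow> z \<in> insert c C \<Longrightarrow> sort N y = Osort \<Longrightarrow> sort N z = Osort \<Longrightarrow>
         less N c' y z \<longleftrightarrow> less N c y z"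
      "\<And>p y. sort N c = Osort \<Longrightarrow> p \<in> insert c C \<Longrightarrow> y \<in> insert c C \<Longrightarrow> sort N p = Psort \<Longrightarrow> sort N y = Osort \<Longrightarrow>
         less N p y c' \<longleftrightarrow> y = c \<or> less N p y c"
      "\<And>p y. sort N c = Osort \<Longrightarrow> p \<in> insert c C \<Longrightarrow> y \<in> insert c C \<Longrightarrow> sort N p = Psort \<Longrightarrow> sort N y = Osort \<Longrightarrow>
         less N p c' y \<longleftrightarrow> less N p c y"
      by (rule new_element[OF S c(1), of "\<lambda>_. c"]) (use c(1) in \<open>auto simp: carrier_def\<close>)
    have cC: "c \<notin> C"
      using C c(2) by auto
    let ?k = "\<lambda>x. if x = c then c' else x"
    have "embedding ?k (induced N (insert c C)) N"
      unfolding embedding_induced_iff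
    proof (intro conjI ballI impI)
      show "inj_on ?k (insert c C)"
        using c'(3) by (auto simp: inj_on_def)
      show "?k ` insert c C \<subseteq> univ N"
        using c'(1) S(2) by auto
      show "sort N (?k a) = sort N a" if "a \<in> insert c C" for a
        using c'(2) by auto
      show "less N (?k x) (?k y) (?k z) = less N x y z" if "x \<in> insert c C" "y \<in> insert c C" "z \<in> insert c C"
        "sort N x = Psort" "sort N y = Osort" "sort N z = Osort" for x y z
      proof (cases "x = c")
        case True
        then show ?thesis using that c'(4)[of y z] by auto
      next
        case False
        have irr: "\<not> less N x w w" if "w \<in> univ N" "sort N w = Osort" for w
          using lin_on_irrefl[OF lin, of x w] \<open>x \<in> insert c C\<close> \<open>sort N x = Psort\<close> S(2) that
          by (auto simp: carrier_def)
        show ?thesis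
          using False that c'(1,2) c'(5)[of x y] c'(6)[of x z] irr[of c] irr[of c'] c(1) by auto
      qed
    qed
    then show ?thesis
      using cC c'(3) by (intro exI[of _ ?k]) auto
  qed
  then obtain t' where t': "set t' \<subseteq> univ N" "sat N (t' @ [c]) (Neg (Eq 0 1))" "equiv_over N M [c] t'"
    using conjugate[of "[c]" "[c]" "Neg (Eq 0 1)"] c(1) by (auto simp: sorts_def)
  then obtain c' where "t' = [c']"
    by (auto simp: equiv_over_def sorts_def)
  then show thesis
    using that t' by auto
qed

text \<open>That is, \<open>d <\<^sub>p e\<close> are outside of \<open>M\<close> and realize the same \<open><\<^sub>p\<close>-cut over \<open>M\<close>.\<close>

definition gap :: "'a \<Rightarrow> 'a \<Rightarrow> 'a \<Rightarrow> bool" where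
  "gap p d e \<longleftrightarrow> d \<in> O_N \<and> e \<in> O_N \<and> less N p d e \<and> (\<forall>m\<in>M. sort N m = Osort \<longrightarrow> less N p m d \<or> less N p e m)"

lemma gap_notin:
  assumes "p \<in> P_N" "gap p d e"
  shows "d \<notin> M" "e \<notin> M"
  using assms lin_on_irrefl[OF lin[OF assms(1)]] lin_on_asym[OF lin[OF assms(1)]]
  unfolding gap_def by (auto simp: carrier_def)

text \<open>No point of \<open>M\<close> separates \<open>d\<close> from \<open>e\<close> in the
  order of \<open>p\<close>, so a conjugate of \<open>d\<close> may jump over \<open>e\<close> in
  this order and stay next to \<open>d\<close> in all others.\<close>

lemma right_conjugate:
  assumes p: "p \<in> P_N" "p \<in> M" and g: "gap p d e"
  obtains c where "c \<in> O_N" "less N p e c" "equiv_over N M [p, d] [p, c]"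
proof -
  have de: "d \<in> O_N" "e \<in> O_N" "less N p d e" and no: "\<And>m. m \<in> M \<Longrightarrow> sort N m = Osort \<Longrightarrow> less N p m d \<or> less N p e m"
    using g by (auto simp: gap_def)
  have dM: "d \<notin> M"
    using gap_notin[OF p(1) g] by blast
  have pd: "p \<in> univ N" "d \<in> univ N" "e \<in> univ N" "sort N d = Osort" "sort N p = Psort" "sort N e = Osort"
    using p(1) de by (auto simp: carrier_def)
  let ?\<chi> = "Less 0 2 1"
  have "\<exists>k. embedding k (induced N (set [p, d] \<union> C)) N \<and> (\<forall>y\<in>C. k y = y) \<and> sat N (map k [p, d] @ [e]) ?\<chi>"
    if C: "finite C" "C \<subseteq> M" for C
  proof -
    let ?S = "insert p (insert d (insert e C))"
    have S: "finite ?S" "?S \<subseteq> univ N"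
      using C pd M(1) by auto
    \<comment> \<open>The new point is placed immediately to the right of \<open>e\<close> for
      \<open>p\<close> and immediately to the right of \<open>d\<close> for every other element of
      sort \<open>P\<close>.\<close>
    obtain c where c: "c \<in> univ N" "sort N c = sort N d" "c \<notin> ?S"
      "\<And>q y. q \<in> ?S \<Longrightarrow> y \<in> ?S \<Longrightarrow> sort N q = Psort \<Longrightarrow> sort N y = Osort \<Longrightarrow>
         less N q y c \<longleftrightarrow> y = ((\<lambda>_. d)(p := e)) q \<or> less N q y (((\<lambda>_. d)(p := e)) q)"
      "\<And>q y. q \<in> ?S \<Longrightarrow> y \<in> ?S \<Longrightarrow> sort N q = Psort \<Longrightarrow> sort N y = Osort \<Longrightarrow>
         less N q c y \<longleftrightarrow> less N q (((\<lambda>_. d)(p := e)) q) y"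
      using pd(4) by (rule_tac new_element[OF S pd(2), of "(\<lambda>_. d)(p := e)"]) (use de in auto)
    let ?k = "\<lambda>x. if x = d then c else x"
    have dC: "d \<notin> C" "d \<noteq> p"
      using C dM p(2) by auto
    have irr: "\<not> less N q w w" if "q \<in> P_N" "w \<in> O_N" for q w
      using lin_on_irrefl[OF lin] that by blast
    have left: "less N q y c \<longleftrightarrow> less N q y d" if "q \<in> insert p C" "y \<in> C" "sort N q = Psort" "sort N y = Osort" for q y
    proof -
      have "q \<in> P_N" "y \<in> O_N" "y \<in> M" "y \<noteq> d"
        using that S C dC by (auto simp: carrier_def)
      \<comment> \<open>The gap enters here: \<open>y\<close> lies in \<open>M\<close>, so it is
        neither \<open>e\<close> nor between \<open>d\<close> and \<open>e\<close>.\<close>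
      moreover have "y = e \<or> less N p y e \<longleftrightarrow> less N p y d"
        using no[OF \<open>y \<in> M\<close> that(4)] de(3) lin_on_trans[OF lin[OF p(1)] \<open>y \<in> O_N\<close> de(1,2)]
          lin_on_asym[OF lin[OF p(1)], of e y] irr[OF p(1) de(2)] de(2) \<open>y \<in> O_N\<close>
        by (auto dest: lin_on_asym[OF lin[OF p(1)]])
      ultimately show ?thesis
        using c(4)[of q y] that by (cases "q = p") auto
    qed
    have right: "less N q c y \<longleftrightarrow> less N q d y" if "q \<in> insert p C" "y \<in> C" "sort N q = Psort" "sort N y = Osort" for q y
    proof -
      have q: "q \<in> P_N" "y \<in> O_N" "y \<noteq> d" "c \<in> O_N" "y \<noteq> c"
        using that S C dC c(1,2,3) pd(4) by (auto simp: carrier_def)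
      have "less N q c y \<longleftrightarrow> \<not> less N q y c"
        using lin_on_total[OF lin[OF q(1)] q(2,4)] lin_on_asym[OF lin[OF q(1)] q(2,4)] q(5) by blast
      also have "\<dots> \<longleftrightarrow> \<not> less N q y d"
        using left[OF that] by simp
      also have "\<dots> \<longleftrightarrow> less N q d y"
        using lin_on_total[OF lin[OF q(1)] q(2) de(1)] lin_on_asym[OF lin[OF q(1)] q(2) de(1)] q(3) by blast
      finally show ?thesis .
    qed
    have "embedding ?k (induced N (insert p (insert d C))) N"
      unfolding embedding_induced_iff
    proof (intro conjI ballI impI)
      show "inj_on ?k (insert p (insert d C))"
        using c(3) by (auto simp: inj_on_def)
      show "?k ` insert p (insert d C) \<subseteq> univ N"
        using c(1) S(2) by auto
      show "sort N (?k a) = sort N a" if "a \<in> insert p (insert d C)" for a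
        using c(2) by auto
      fix x y z assume a: "x \<in> insert p (insert d C)" "y \<in> insert p (insert d C)" "z \<in> insert p (insert d C)"
        "sort N x = Psort" "sort N y = Osort" "sort N z = Osort"
      then have "x \<in> insert p C" "x \<noteq> d" "y \<in> insert d C" "z \<in> insert d C"
        using pd by auto
      moreover have "x \<in> P_N" "c \<in> O_N" "d \<in> O_N"
        using a S(2) c(1,2) de pd by (auto simp: carrier_def)
      ultimately show "less N (?k x) (?k y) (?k z) = less N x y z"
        using left[of x y] right[of x z] irr[of x c] irr[of x d] a by auto
    qed
    moreover have "less N p e c"
      using c(4)[of p e] pd by simp
    ultimately show ?thesis
      using dC by (intro exI[of _ ?k]) auto
  qed
  then obtain t' where t': "set t' \<subseteq> univ N" "sat N (t' @ [e]) ?\<chi>" "equiv_over N M [p, d] t'"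
    using conjugate[of "[p, d]" "[e]" ?\<chi>] pd by (auto simp: sorts_def)
  then obtain p' c where pc: "t' = [p', c]" "sort N c = Osort"
    using pd by (auto simp: equiv_over_def sorts_def)
  \<comment> \<open>Since \<open>p\<close> is in \<open>M\<close>, the type over \<open>M\<close>
    fixes the first entry by an equation.\<close>
  have "p' = p"
    using equiv_over_sat[OF t'(3), of "[p]" "Eq 0 2"] p(2) pc by (auto simp: sorts_def)
  then show thesis
    using that t' pc by (auto simp: carrier_def)
qed

section \<open>Existence and first properties of Morley sequences\<close>

lemma morley_exists:
  assumes q: "global_type N \<sigma> q"
  obtains bs where "morley_sequence N M \<sigma> q bs"
proof -
  have "\<exists>f. \<forall>i :: nat. f i \<in> tuples N \<sigma> \<and> realizes N (f i) (restrict_type q (M \<union> (\<Union>j<i. set (f j))))"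
  proof (rule dependent_wellorder_choice[where P = "\<lambda>f (i :: nat) r. r \<in> tuples N \<sigma> \<and>
      realizes N r (restrict_type q (M \<union> (\<Union>j<i. set (f j))))"])
    fix f g :: "nat \<Rightarrow> 'a list" and i r
    assume "\<And>z. z < i \<Longrightarrow> f z = g z"
    then have "(\<Union>j<i. set (f j)) = (\<Union>j<i. set (g j))"
      by auto
    then show "(r \<in> tuples N \<sigma> \<and> realizes N r (restrict_type q (M \<union> (\<Union>j<i. set (f j))))) =
      (r \<in> tuples N \<sigma> \<and> realizes N r (restrict_type q (M \<union> (\<Union>j<i. set (g j)))))"
      by simp
  next
    fix i and f :: "nat \<Rightarrow> 'a list"
    assume f: "\<And>j. j < i \<Longrightarrow> f j \<in> tuples N \<sigma> \<and>
      realizes N (f j) (restrict_type q (M \<union> (\<Union>k<j. set (f k))))"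
    let ?A = "M \<union> (\<Union>j<i. set (f j))"
    have "?A \<subseteq> univ N"
      using f M(1) by (fastforce simp: tuples_def)
    moreover have "|?A| <o \<kappa>"
      by (rule small_Un) simp
    moreover have "restrict_type q ?A \<subseteq> formulas_over N ?A \<sigma>"
      using q by (auto simp: restrict_type_def global_type_def formulas_over_def)
    moreover have "consistent N \<sigma> (restrict_type q ?A)"
    proof -
      have "restrict_type q ?A \<subseteq> q"
        by (auto simp: restrict_type_def)
      then show ?thesis
        using q unfolding global_type_def consistent_def by (meson subset_trans)
    qed
    ultimately show "\<exists>r. r \<in> tuples N \<sigma> \<and> realizes N r (restrict_type q ?A)"
      using saturation by metis
  qed
  then show thesis
    using that by (auto simp: morley_sequence_def)
qed

text \<open>Completeness of \<open>q\<close> gives the converse: if the formula is not in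
  \<open>q\<close>, its negation is, and \<open>bs i\<close> satisfies it.\<close>

lemma morley_in_type:
  assumes q: "global_type N \<sigma> q" and bs: "morley_sequence N M \<sigma> q bs"
    and c: "set c \<subseteq> M \<union> (\<Union>j<i. set (bs j))" "wf_fm (\<sigma> @ sorts N c) \<phi>"
  shows "(\<phi>, c) \<in> q \<longleftrightarrow> sat N (bs i @ c) \<phi>"
proof -
  have "set (bs j) \<subseteq> univ N" for j
    using bs by (auto simp: morley_sequence_def tuples_def)
  then have "(\<phi>, c) \<in> formulas_over N (univ N) \<sigma>"
    using c M(1) unfolding formulas_over_def by blast
  then have "(\<phi>, c) \<in> q \<or> (Neg \<phi>, c) \<in> q"
    using q by (auto simp: global_type_def)
  moreover have "sat N (bs i @ c) \<psi>" if "(\<psi>, c) \<in> q" for \<psi>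
    using bs that c(1) by (auto simp: morley_sequence_def realizes_def restrict_type_def)
  ultimately show ?thesis
    by fastforce
qed

lemma morley_equiv:
  assumes q: "global_type N (sorts N b) q" and bs: "morley_sequence N M (sorts N b) q bs"
    and b: "tp N M b \<subseteq> q" "set b \<subseteq> univ N"
  shows "equiv_over N M b (bs i)"
proof (rule equiv_overI)
  show "sorts N b = sorts N (bs i)"
    using bs by (auto simp: morley_sequence_def tuples_def)
  fix \<phi> c assume *: "set c \<subseteq> M" "wf_fm (sorts N b @ sorts N c) \<phi>" "sat N (b @ c) \<phi>"
  then have "(\<phi>, c) \<in> q"
    using b(1) by (auto simp: tp_def formulas_over_def)
  then show "sat N (bs i @ c) \<phi>"
    using morley_in_type[OF q bs, of c i \<phi>] * by blast
qed

lemma morley_univ: "morley_sequence N M \<sigma> q bs \<Longrightarrow> set (bs i) \<subseteq> univ N"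
  by (auto simp: morley_sequence_def tuples_def)

lemma morley_sorts: "morley_sequence N M \<sigma> q bs \<Longrightarrow> sorts N (bs i) = \<sigma>"
  by (auto simp: morley_sequence_def tuples_def)

text \<open>A common element \<open>x\<close> outside of \<open>M\<close> would put the equation of
  a variable with \<open>x\<close> into \<open>q\<close>. Invariance would add the equation with a
  distinct conjugate of \<open>x\<close>, which is inconsistent.\<close>

lemma morley_disjoint:
  assumes q: "invariant_type N M \<sigma> q" and bs: "morley_sequence N M \<sigma> q bs" and ij: "i < j"
  shows "set (bs i) \<inter> set (bs j) \<subseteq> M"
proof
  fix x assume x: "x \<in> set (bs i) \<inter> set (bs j)"
  have gl: "global_type N \<sigma> q"
    using q by (simp add: invariant_type_def)
  have so: "sorts N (bs j) = \<sigma>"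
    by (rule morley_sorts[OF bs])
  have len: "length \<sigma> = length (bs j)"
    using so by (auto simp: sorts_def)
  obtain k where k: "k < length (bs j)" "bs j ! k = x"
    using x by (auto simp: in_set_conv_nth)
  have xN: "x \<in> univ N"
    using x morley_univ[OF bs] by blast
  let ?\<phi> = "Eq k (length \<sigma>)"
  have wf: "wf_fm (\<sigma> @ sorts N [y]) ?\<phi>" if "sort N y = sort N x" for y
    using k so that len by (auto simp: sorts_def nth_append)
  show "x \<in> M"
  proof (rule ccontr)
    assume "x \<notin> M"
    then obtain x' where x': "x' \<in> univ N" "x' \<noteq> x" "equiv_over N M [x] [x']"
      using distinct_conjugate[OF xN] by blast
    have "(?\<phi>, [x]) \<in> q"
      using morley_in_type[OF gl bs _ wf[of x], of j] x ij k len by (auto simp: nth_append)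
    moreover have "(?\<phi>, [x]) \<in> q \<longleftrightarrow> (?\<phi>, [x']) \<in> q"
      using q x' xN wf[of x] unfolding invariant_type_def by auto
    ultimately have "finite {(?\<phi>, [x]), (?\<phi>, [x'])} \<and> {(?\<phi>, [x]), (?\<phi>, [x'])} \<subseteq> q"
      by simp
    then obtain a where "a \<in> tuples N \<sigma>" "realizes N a {(?\<phi>, [x]), (?\<phi>, [x'])}"
      using gl unfolding global_type_def consistent_def by meson
    moreover from this have "length a = length \<sigma>"
      by (auto simp: tuples_def sorts_def)
    ultimately show False
      using x'(2) k len by (auto simp: realizes_def nth_append)
  qed
qed

end

section \<open>Kim-dividing of intervals\<close>

context DLOp_monster
begin

text \<open>If \<open>k x\<close> is in \<open>M\<close>, then \<open>k\<close> fixes it, so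
  \<open>k x\<close> and \<open>x\<close> have the same image and injectivity applies.\<close>

lemma embedding_fixes_M:
  assumes k: "embedding k (induced N (S \<union> M)) N" "\<And>m. m \<in> M \<Longrightarrow> k m = m" and x: "x \<in> S" "k x \<in> M"
  shows "k x = x"
  using embedding_eq_iff[OF k(1), of "k x" x] k(2)[OF x(2)] x by simp

text \<open>The formula is \<open>d < y < e\<close> in the order of \<open>p\<close>, with variables
  \<open>y\<close>, \<open>p\<close>, \<open>d\<close>, \<open>e\<close>. For an invariant type that
  puts both ends to the left of the cut, the later intervals of a Morley sequence lie entirely to
  the left of the earlier ones.\<close>

lemma gap_kim_divides:
  assumes p: "p \<in> P_N" "p \<in> M" and g: "gap p d e"
  shows "kim_divides N M [Osort] (Conj (Less 1 2 0) (Less 1 0 3)) [p, d, e]"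
proof -
  let ?\<chi> = "Conj (Less 1 2 0) (Less 1 0 3)"
  \<comment> \<open>The pair \<open>(d, e)\<close> is placed at the left end of its cut over \<open>M\<close> for all \<open>p\<close> in \<open>M\<close>, and above
    everything for the other \<open>p\<close>; both choices are \<open>M\<close>-invariant.\<close>
  define \<alpha> where "\<alpha> u = (if u then e else d)" for u
  have de: "d \<in> O_N" "e \<in> O_N" "less N p d e" and no: "\<And>m. m \<in> M \<Longrightarrow> sort N m = Osort \<Longrightarrow> less N p m d \<or> less N p e m"
    using g by (auto simp: gap_def)
  have dM: "d \<notin> M" "e \<notin> M" and neq: "d \<noteq> e"
    using gap_notin[OF p(1) g] lin_on_irrefl[OF lin[OF p(1)] de(1)] de(3) by auto
  have \<alpha>: "\<alpha> u \<in> O_N" "\<alpha> u \<notin> M" "\<alpha> u = \<alpha> v \<longleftrightarrow> u = v" for u v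
    using de dM neq by (auto simp: \<alpha>_def)
  \<comment> \<open>\<open>Inr False\<close> and \<open>Inr True\<close> are the new copies of
    \<open>d\<close> and \<open>e\<close>. For \<open>q\<close> in \<open>M\<close>, a point lies
    below a copy only if some \<open>m\<close> in \<open>M\<close> witnesses it, which is the left
    end of the cut; for other \<open>q\<close> every point lies below both.\<close>
  define G where "G = (case_sum (\<lambda>q y u. q \<in> M \<longrightarrow> (\<exists>m\<in>M. sort N m = Osort \<and> (y = m \<or> less N q y m) \<and> less N q m (\<alpha> u)))
    (\<lambda>_ _ _. False) :: 'a + bool \<Rightarrow> 'a \<Rightarrow> bool \<Rightarrow> bool)"
  define rX where "rX = (case_sum (\<lambda>q u v. if q \<in> M then less N q (\<alpha> u) (\<alpha> v) else \<not> u \<and> v) (\<lambda>_ _ _. False) ::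
    'a + bool \<Rightarrow> bool \<Rightarrow> bool \<Rightarrow> bool)"
  define rA where "rA = (case_sum (less N) (\<lambda>_ _ _. False) :: 'a + bool \<Rightarrow> 'a \<Rightarrow> 'a \<Rightarrow> bool)"
  define L where "L = glue (univ N) UNIV (sort N) (\<lambda>_. Osort) rA rX G"
  define t where "t = [Inl p, Inr False, Inr True :: 'a + bool]"
  have L: "linear L"
    unfolding L_def
  proof (rule linear_glue; unfold carrier_glue_Psort)
    fix x :: "'a + bool"
    assume "(\<exists>y\<in>univ N. sort N y = Psort \<and> x = Inl y) \<or> (\<exists>z\<in>UNIV. Osort = Psort \<and> x = Inr z)"
    then obtain q where q: "x = Inl q" "q \<in> P_N"
      by (auto simp: carrier_def)
    show "lin_on {y \<in> univ N. sort N y = Osort} (rA x)"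
      using lin[OF q(2)] q(1) by (simp add: rA_def carrier_def)
    note tr = lin_on_trans[OF lin[OF q(2)]]
    show "lin_on {x \<in> UNIV. Osort = Osort} (rX x)"
    proof (cases "q \<in> M")
      case True
      have "lin_on UNIV (\<lambda>u v. less N q (\<alpha> u) (\<alpha> v))"
        by (rule lin_on_pullback[OF lin[OF q(2)]]) (use \<alpha> in \<open>auto simp: inj_on_def\<close>)
      then show ?thesis
        using True q(1) by (simp add: rX_def)
    next
      case False
      then show ?thesis
        using q(1) by (intro lin_onI) (auto simp: rX_def)
    qed
    show "G x z u" if a: "y \<in> univ N" "sort N y = Osort" "z \<in> univ N" "sort N z = Osort" "rA x z y" "G x y u" for y z u
      unfolding G_def q(1) sum.case
    proof
      assume "q \<in> M"
      then obtain m where m: "m \<in> M" "sort N m = Osort" "y = m \<or> less N q y m" "less N q m (\<alpha> u)"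
        using a q(1) by (auto simp: G_def)
      then have "less N q z m"
        using a q(1) tr[of z y m] M(1) by (auto simp: rA_def carrier_def)
      then show "\<exists>m\<in>M. sort N m = Osort \<and> (z = m \<or> less N q z m) \<and> less N q m (\<alpha> u)"
        using m by blast
    qed
    show "G x y w" if a: "y \<in> univ N" "sort N y = Osort" "rX x u w" "G x y u" for y u w
      unfolding G_def q(1) sum.case
    proof
      assume qM: "q \<in> M"
      then obtain m where m: "m \<in> M" "sort N m = Osort" "y = m \<or> less N q y m" "less N q m (\<alpha> u)"
        using a q(1) by (auto simp: G_def)
      then have "less N q m (\<alpha> w)"
        using a q(1) tr[of m "\<alpha> u" "\<alpha> w"] M(1) \<alpha>(1) qM by (auto simp: rX_def carrier_def)
      then show "\<exists>m\<in>M. sort N m = Osort \<and> (y = m \<or> less N q y m) \<and> less N q m (\<alpha> w)"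
        using m by blast
    qed
  qed
  interpret ext: DLOp_extension N L Inl t
  proof
    show "linear L" by (rule L)
    show "embedding Inl N L"
      by (auto simp: embedding_def L_def carrier_def rA_def)
    show "set t \<subseteq> univ L"
      using p(1) by (auto simp: t_def L_def carrier_def)
  qed
  have sorts_t: "sorts L t = sorts N [p, d, e]"
    using p(1) de by (simp add: t_def L_def sorts_def carrier_def)
  have inv: "invariant_type N M (sorts L t) ext.gtp"
  proof (rule ext.invariant_gtp)
    fix c c' assume c: "set c \<subseteq> univ N" "set c' \<subseteq> univ N" "equiv_over N M c c'"
    obtain k where k: "embedding k (induced N (set c \<union> M)) N" "map k c = c'" and kM: "\<And>m. m \<in> M \<Longrightarrow> k m = m"
      using equiv_over_embedding[OF c(3,1,2) M(1)] by blast
    let ?h = "map_sum k id"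
    \<comment> \<open>\<open>G\<close> and \<open>rX\<close> distinguish whether \<open>q\<close> is
      in \<open>M\<close>, so \<open>k\<close> has to respect this.\<close>
    have in_M: "k q \<in> M \<longleftrightarrow> q \<in> M" if "q \<in> set c \<union> M" for q
      using embedding_fixes_M[OF k(1) kM, of q] kM that by auto
    have G: "G (Inl (k q)) (k y) u \<longleftrightarrow> G (Inl q) y u" if "q \<in> set c \<union> M" "y \<in> set c \<union> M" "sort N q = Psort" "sort N y = Osort" for q y u
    proof (cases "q \<in> M")
      case True
      have "(k y = m \<or> less N q (k y) m) \<longleftrightarrow> (y = m \<or> less N q y m)" if "m \<in> M" "sort N m = Osort" for m
        using embedding_eq_iff[OF k(1), of y m] embedding_less[OF k(1), of q y m] kM[OF True] kM[OF that(1)]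
          that True \<open>y \<in> set c \<union> M\<close> \<open>sort N q = Psort\<close> \<open>sort N y = Osort\<close> by simp
      then show ?thesis
        using True kM[OF True] unfolding G_def by auto
    next
      case False
      then show ?thesis
        using in_M[OF that(1)] by (simp add: G_def)
    qed
    have rX: "rX (Inl (k q)) u v \<longleftrightarrow> rX (Inl q) u v" if "q \<in> set c \<union> M" for q u v
      using in_M[OF that] kM[of q] by (auto simp: rX_def)
    have "embedding ?h (induced L (Inl ` (set c \<union> M) \<union> range Inr)) L"
      unfolding embedding_induced_iff
    proof (intro conjI ballI impI)
      show "inj_on ?h (Inl ` (set c \<union> M) \<union> range Inr)"
        using embedding_eq_iff[OF k(1)] by (auto simp: inj_on_def)
      show "?h ` (Inl ` (set c \<union> M) \<union> range Inr) \<subseteq> univ L"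
        using embedding_univ[OF k(1)] by (auto simp: L_def)
      show "sort L (?h a) = sort L a" if "a \<in> Inl ` (set c \<union> M) \<union> range Inr" for a
        using that embedding_sort[OF k(1)] by (auto simp: L_def)
      fix x y z
      assume a: "x \<in> Inl ` (set c \<union> M) \<union> range Inr" "y \<in> Inl ` (set c \<union> M) \<union> range Inr"
        "z \<in> Inl ` (set c \<union> M) \<union> range Inr" "sort L x = Psort" "sort L y = Osort" "sort L z = Osort"
      then obtain q where q: "x = Inl q" "q \<in> set c \<union> M" "sort N q = Psort"
        by (auto simp: L_def)
      show "less L (?h x) (?h y) (?h z) = less L x y z"
        using a q G rX embedding_less[OF k(1), of q] by (cases y; cases z) (auto simp: L_def rA_def)
    qed
    moreover have "set t \<union> Inl ` set c \<subseteq> Inl ` (set c \<union> M) \<union> range Inr"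
      using p(2) by (auto simp: t_def)
    ultimately have "embedding ?h (induced L (set t \<union> Inl ` set c)) L"
      by (rule embedding_mono)
    moreover have "\<forall>x\<in>set t. ?h x = x"
      using kM[OF p(2)] by (auto simp: t_def)
    moreover have "map (?h \<circ> Inl) c = map Inl c'"
      by (simp flip: k(2))
    ultimately show "\<exists>h. embedding h (induced L (set t \<union> Inl ` set c)) L \<and> (\<forall>x\<in>set t. h x = x) \<and>
        map (h \<circ> Inl) c = map Inl c'"
      by blast
  qed
  \<comment> \<open>Against points of \<open>M\<close> itself, \<open>G\<close> is the order of
    \<open>N\<close>, since such a point is its own witness. Hence \<open>(p, d, e)\<close> is a
    copy of \<open>t\<close> over \<open>M\<close>.\<close>
  have "tp N M [p, d, e] \<subseteq> ext.gtp"
  proof safe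
    fix \<phi> c assume "(\<phi>, c) \<in> tp N M [p, d, e]"
    then have c: "set c \<subseteq> M" "wf_fm (sorts L t @ sorts N c) \<phi>" "sat N ([p, d, e] @ c) \<phi>"
      by (auto simp: tp_def formulas_over_def sorts_t)
    let ?f = "case_sum id \<alpha>"
    have "embedding ?f (induced L (Inl ` M \<union> range Inr)) N"
      unfolding embedding_induced_iff
    proof (intro conjI ballI impI)
      show "inj_on ?f (Inl ` M \<union> range Inr)"
        using \<alpha>(2,3) by (auto simp: inj_on_def)
      show "?f ` (Inl ` M \<union> range Inr) \<subseteq> univ N"
        using M(1) \<alpha>(1) by (auto simp: carrier_def)
      show "sort N (?f a) = sort L a" if "a \<in> Inl ` M \<union> range Inr" for a
        using that \<alpha>(1) by (auto simp: L_def carrier_def)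
      fix x y z assume a: "x \<in> Inl ` M \<union> range Inr" "y \<in> Inl ` M \<union> range Inr" "z \<in> Inl ` M \<union> range Inr"
        "sort L x = Psort" "sort L y = Osort" "sort L z = Osort"
      then obtain q where q: "x = Inl q" "q \<in> M" "sort N q = Psort"
        by (auto simp: L_def)
      have qP: "q \<in> P_N"
        using q M(1) by (auto simp: carrier_def)
      have O: "w \<in> O_N" if "w \<in> M" "sort N w = Osort" for w
        using that M(1) by (auto simp: carrier_def)
      have G: "G (Inl q) w u \<longleftrightarrow> less N q w (\<alpha> u)" if "w \<in> M" "sort N w = Osort" for w u
        using that q(2) lin_on_trans[OF lin[OF qP] O[OF that] O \<alpha>(1)] by (auto simp: G_def)
      have G': "\<not> G (Inl q) w u \<longleftrightarrow> less N q (\<alpha> u) w" if "w \<in> M" "sort N w = Osort" for w u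
        using G[OF that] lin_on_total[OF lin[OF qP] O[OF that] \<alpha>(1)] lin_on_asym[OF lin[OF qP] O[OF that] \<alpha>(1)]
          \<alpha>(2) that(1) by metis
      show "less N (?f x) (?f y) (?f z) = less L x y z"
        using a q G G' by (cases y; cases z) (auto simp: L_def rA_def rX_def)
    qed
    moreover have "set t \<union> Inl ` set c \<subseteq> Inl ` M \<union> range Inr"
      using p(2) c(1) by (auto simp: t_def)
    ultimately have f: "embedding ?f (induced L (set t \<union> Inl ` set c)) N"
      by (rule embedding_mono)
    have "map ?f t = [p, d, e]" "map (?f \<circ> Inl) c = c"
      by (simp_all add: t_def \<alpha>_def map_idI)
    then show "(\<phi>, c) \<in> ext.gtp"
      using ext.gtp_iff[OF _ c(2) f] c(1,3) M(1) by auto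
  qed
  moreover obtain bs where bs: "morley_sequence N M (sorts L t) ext.gtp bs"
    using morley_exists[OF ext.global_gtp] .
  moreover have "divides_along N [Osort] ?\<chi> bs"
    unfolding divides_along_def
  proof
    assume con: "consistent N [Osort] (range (\<lambda>i. (?\<chi>, bs i)))"
    have eq: "equiv_over N M [p, d, e] (bs i)" for i
      using morley_equiv[of "[p, d, e]" ext.gtp bs i] ext.global_gtp bs calculation(1) p(1) de
      by (simp add: sorts_t carrier_def)
    have "\<exists>u v. bs i = [p, u, v] \<and> u \<in> O_N \<and> v \<in> O_N" for i
    proof -
      obtain q u v where b: "bs i = [q, u, v]"
        using eq[of i] by (auto simp: equiv_over_def sorts_def)
      moreover have "q = p"
        using equiv_over_sat[OF eq[of i], of "[p]" "Eq 0 3"] p(2) b by (simp add: sorts_def)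
      ultimately show ?thesis
        using eq[of i] de morley_univ[OF bs, of i] by (auto simp: equiv_over_def sorts_def carrier_def)
    qed
    then obtain u v where b: "\<And>i. bs i = [p, u i, v i]" and uv: "\<And>i. u i \<in> O_N" "\<And>i. v i \<in> O_N"
      by metis
    obtain k where k: "embedding k (induced N (set [p, d, e] \<union> M)) N" "map k [p, d, e] = bs 0" and kM: "\<And>m. m \<in> M \<Longrightarrow> k m = m"
      using equiv_over_embedding[OF eq[of 0] _ morley_univ[OF bs] M(1)] p(1) de by (auto simp: carrier_def)
    have kd: "k d = u 0" "k p = p"
      using k(2) b by simp_all
    \<comment> \<open>\<open>u 0\<close> is conjugate to \<open>d\<close> over \<open>M\<close>. A
      witness \<open>m\<close> from \<open>u 0\<close> up to \<open>e\<close> would therefore lie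
      between \<open>d\<close> and \<open>e\<close>, against the gap.\<close>
    have nG: "\<not> G (Inl p) (u 0) True"
    proof
      assume "G (Inl p) (u 0) True"
      then obtain m where m: "m \<in> M" "sort N m = Osort" "u 0 = m \<or> less N p (u 0) m" "less N p m e"
        using p(2) by (auto simp: G_def \<alpha>_def)
      then have mO: "m \<in> O_N"
        using M(1) by (auto simp: carrier_def)
      have "d = m \<or> less N p d m"
        using embedding_eq_iff[OF k(1), of d m] embedding_less[OF k(1), of p d m] m kM[OF m(1)] kd p(1) de
        by (auto simp: carrier_def)
      then have "less N p d m"
        using dM(1) m(1) by auto
      then show False
        using no[OF m(1,2)] m(4) lin_on_asym[OF lin[OF p(1)] de(1) mO] lin_on_asym[OF lin[OF p(1)] mO de(2)] by blast
    qed
    \<comment> \<open>The right end of the second interval lies to the left of the left end of the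
      first. In \<open>Less 0 2 3\<close> the indices denote \<open>p\<close>, the right end and the
      parameter \<open>u 0\<close>.\<close>
    have "less N p (v 1) (u 0)"
    proof -
      have u0: "set [u 0] \<subseteq> univ N"
        using uv(1)[of 0] by (simp add: carrier_def)
      have wf: "wf_fm (sorts L t @ sorts N [u 0]) (Less 0 2 3)"
        unfolding sorts_t
        using uv(1)[of 0] p(1) de by (simp add: sorts_def carrier_def numeral_2_eq_2 numeral_3_eq_3)
      obtain f where f: "embedding f (induced L (set t \<union> Inl ` set [u 0])) N"
        using ext.realization[OF _ u0] by blast
      have "less N (f (Inl p)) (f (Inr True)) (f (Inl (u 0))) = less L (Inl p) (Inr True) (Inl (u 0))"
        by (rule embedding_less[OF f]) (use uv(1)[of 0] p(1) in \<open>auto simp: t_def L_def carrier_def\<close>)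
      then have "sat N (map f t @ map (f \<circ> Inl) [u 0]) (Less 0 2 3)"
        using nG by (simp add: t_def L_def numeral_2_eq_2 numeral_3_eq_3)
      then have "(Less 0 2 3, [u 0]) \<in> ext.gtp"
        using ext.gtp_iff[OF u0 wf f] by blast
      moreover have "set [u 0] \<subseteq> M \<union> (\<Union>j<1. set (bs j))"
        using b[of 0] by (auto simp: lessThan_Suc)
      ultimately have "sat N (bs 1 @ [u 0]) (Less 0 2 3)"
        using morley_in_type[OF ext.global_gtp bs _ wf] by blast
      then show ?thesis
        by (simp add: b numeral_2_eq_2 numeral_3_eq_3)
    qed
    moreover obtain a where a: "a \<in> tuples N [Osort]" "realizes N a {(?\<chi>, bs 0), (?\<chi>, bs 1)}"
    proof -
      have "finite {(?\<chi>, bs 0), (?\<chi>, bs 1)} \<and> {(?\<chi>, bs 0), (?\<chi>, bs 1)} \<subseteq> range (\<lambda>i. (?\<chi>, bs i))"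
        by blast
      then show thesis
        using con that unfolding consistent_def by meson
    qed
    moreover obtain y where y: "a = [y]" "y \<in> O_N"
      using a(1) by (auto simp: tuples_Cons)
    moreover have "less N p (u 0) y" "less N p y (v 1)"
      using a(2) b y(1) by (simp_all add: realizes_def numeral_2_eq_2 numeral_3_eq_3)
    ultimately show False
      using lin_on_trans[OF lin[OF p(1)], of y "v 1" "u 0"] lin_on_asym[OF lin[OF p(1)], of "u 0" y] uv by blast
  qed
  ultimately show ?thesis
    using inv unfolding kim_divides_def sorts_t by blast
qed

end

section \<open>Amalgamation along a Morley sequence\<close>

context DLOp_monster
begin

text \<open>The copies \<open>cs j\<close> of \<open>b\<close> and one copy of the remaining entries
  of \<open>a\<close> are amalgamated into a linear structure \<open>E\<close> and sent back into
  \<open>N\<close>. Of the \<open>cs j\<close>, the argument uses conjugacy over \<open>M\<close>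
  and disjointness outside of \<open>M\<close>; two copies can make conflicting demands on the place
  of an entry of \<open>a\<close> only if it lies in a gap.\<close>

lemma consistent_along:
  assumes a: "set a \<subseteq> univ N" and b: "set b \<subseteq> univ N"
    and wf: "wf_fm (sorts N a @ sorts N b) \<phi>" and sat: "sat N (a @ b) \<phi>"
    and cs: "\<And>j. set (cs j) \<subseteq> univ N" "\<And>j. equiv_over N M b (cs j)"
    and disj: "\<And>i j :: nat. i < j \<Longrightarrow> set (cs i) \<inter> set (cs j) \<subseteq> M"
    and ab: "set a \<inter> set b \<subseteq> M"
    and no_gap: "\<And>p d e y. p \<in> set b \<Longrightarrow> p \<in> M \<Longrightarrow> p \<in> P_N \<Longrightarrow> d \<in> set b \<Longrightarrow> e \<in> set b \<Longrightarrow> y \<in> set a \<Longrightarrow> y \<in> O_N \<Longrightarrow>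
      gap p d e \<Longrightarrow> less N p d y \<Longrightarrow> less N p y e \<Longrightarrow> False"
  shows "consistent N (sorts N a) (range (\<lambda>j. (\<phi>, cs j)))"
  unfolding consistent_def
proof (intro allI impI)
  fix p0 assume "finite p0 \<and> p0 \<subseteq> range (\<lambda>j. (\<phi>, cs j))"
  then obtain J where J: "finite J" "p0 = (\<lambda>j. (\<phi>, cs j)) ` J"
    by (meson finite_subset_image)
  have "\<exists>k. embedding k (induced N (set b \<union> M)) N \<and> map k b = cs j \<and> (\<forall>m\<in>M. k m = m)" for j
    using equiv_over_embedding[OF cs(2) b cs(1) M(1)] by metis
  then obtain k where k: "\<And>j. embedding (k j) (induced N (set b \<union> M)) N" "\<And>j. map (k j) b = cs j"
    and kM: "\<And>j m. m \<in> M \<Longrightarrow> k j m = m"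
    by metis
  have k_in: "k j x \<in> set (cs j)" if "x \<in> set b" for j x
    using that by (auto simp flip: k(2))
  have k_M: "k j x = x" if "x \<in> set b" "k j x \<in> M" for j x
    using embedding_fixes_M[OF k(1) kM that] .
  \<comment> \<open>By disjointness, elements of different copies coincide only in \<open>M\<close>,
    where every \<open>k j\<close> is the identity.\<close>
  have k_eq: "k i x = k j y \<longleftrightarrow> x = y \<and> (i = j \<or> k i x \<in> M)" if "x \<in> set b" "y \<in> set b" for i j x y
  proof (cases "i = j")
    case True
    then show ?thesis
      using embedding_eq_iff[OF k(1), of x y i] that by simp
  next
    case False
    then have "k i x \<in> M" if "k i x = k j y"
      using disj[of i j] disj[of j i] k_in[OF \<open>x \<in> set b\<close>, of i] k_in[OF \<open>y \<in> set b\<close>, of j] that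
      by (cases "i < j") auto
    then show ?thesis
      using that False k_M kM by metis
  qed
  note k_sort = embedding_sort[OF k(1)]
  have k_less: "less N (k j x) (k j y) (k j z) = less N x y z" if "x \<in> set b \<union> M" "y \<in> set b \<union> M" "z \<in> set b \<union> M"
    "sort N x = Psort" "sort N y = Osort" "sort N z = Osort" for j x y z
    using embedding_less[OF k(1) that] .
  define C where "C = (\<Union>j\<in>J. k j ` set b)"
  define X where "X = set a - set b"
  \<comment> \<open>The entry of \<open>b\<close> of which \<open>u\<close> is a copy; it is unique
    by \<open>k_eq\<close>, even when \<open>u\<close> occurs in several copies.\<close>
  define h where "h u = (SOME x. x \<in> set b \<and> (\<exists>j\<in>J. u = k j x))" for u
  have h: "h u \<in> set b \<and> (\<exists>j\<in>J. u = k j (h u))" if "u \<in> C" for u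
    unfolding h_def by (rule someI_ex) (use that in \<open>auto simp: C_def\<close>)
  have kC: "k j x \<in> C" if "j \<in> J" "x \<in> set b" for j x
    using that by (auto simp: C_def)
  have hk: "h (k j x) = x" if "j \<in> J" "x \<in> set b" for j x
    using h[OF kC[OF that]] k_eq[OF that(2)] by metis
  have CN: "C \<subseteq> univ N"
    using embedding_univ[OF k(1)] by (auto simp: C_def)
  have h_sort: "sort N (h u) = sort N u" if "u \<in> C" for u
    using h[OF that] k_sort by (metis UnI1)
  have hN: "h u \<in> univ N" if "u \<in> C" for u
    using h[OF that] b by blast
  have XN: "X \<subseteq> univ N"
    using a by (auto simp: X_def)
  have CO: "{y \<in> C. sort N y = Osort} \<subseteq> O_N" and XO: "{y \<in> X. sort N y = Osort} \<subseteq> O_N"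
    using CN XN by (auto simp: carrier_def)
  \<comment> \<open>The orders of new elements \<open>x\<close> of sort \<open>P\<close> are pulled back lexicographically along \<open>h\<close>, as they
    are not prescribed between different members of the sequence.\<close>
  define rA where "rA = (case_sum (less N) (\<lambda>x u v. less N x (h u) (h v) \<or> h u = h v \<and> less N x u v) ::
    'a + 'a \<Rightarrow> 'a \<Rightarrow> 'a \<Rightarrow> bool)"
  define rX where "rX = (case_sum (\<lambda>p. less N (h p)) (less N) :: 'a + 'a \<Rightarrow> 'a \<Rightarrow> 'a \<Rightarrow> bool)"
  \<comment> \<open>For a copied \<open>p\<close>, an element of \<open>C\<close> lies below
    \<open>v\<close> exactly if a copy \<open>k j x\<close> of some \<open>x\<close> below
    \<open>v\<close> forces it to; \<open>j\<close> ranges over the copies in which \<open>p\<close>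
    corresponds to \<open>h p\<close>. For a new \<open>p\<close>, an element lies where its
    original in \<open>b\<close> does.\<close>
  define G where "G = (case_sum
      (\<lambda>p u v. \<exists>j\<in>J. \<exists>x\<in>set b. k j (h p) = p \<and> sort N x = Osort \<and> (u = k j x \<or> less N p u (k j x)) \<and> less N (h p) x v)
      (\<lambda>p u v. less N p (h u) v) :: 'a + 'a \<Rightarrow> 'a \<Rightarrow> 'a \<Rightarrow> bool)"
  define E where "E = glue C X (sort N) (sort N) rA rX G"
  have E: "linear E"
    unfolding E_def
  proof (rule linear_glue; unfold carrier_glue_Psort)
    fix w :: "'a + 'a"
    assume w: "(\<exists>y\<in>C. sort N y = Psort \<and> w = Inl y) \<or> (\<exists>x\<in>X. sort N x = Psort \<and> w = Inr x)"
    have hO: "h u \<in> O_N" if "u \<in> C" "sort N u = Osort" for u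
      using hN h_sort that by (auto simp: carrier_def)
    show "lin_on {y \<in> C. sort N y = Osort} (rA w)"
      using w
    proof (elim disjE bexE conjE)
      fix p assume "p \<in> C" "sort N p = Psort" "w = Inl p"
      then show ?thesis
        using lin_on_mono[OF lin CO, of p] CN by (auto simp: rA_def carrier_def)
    next
      fix p assume p: "p \<in> X" "sort N p = Psort" "w = Inr p"
      then have l: "lin_on O_N (less N p)"
        using XN by (intro lin) (auto simp: carrier_def)
      note tr = lin_on_trans[OF l]
      show ?thesis
        unfolding p(3) rA_def sum.case
      proof (rule lin_onI)
        fix u assume u: "u \<in> {y \<in> C. sort N y = Osort}"
        then show "\<not> (less N p (h u) (h u) \<or> h u = h u \<and> less N p u u)"
          using lin_on_irrefl[OF l] hO[of u] CO by blast
        fix v assume v: "v \<in> {y \<in> C. sort N y = Osort}"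
        show "(less N p (h u) (h v) \<or> h u = h v \<and> less N p u v) \<or> (less N p (h v) (h u) \<or> h v = h u \<and> less N p v u)" if "u \<noteq> v"
          using lin_on_total[OF l, of "h u" "h v"] lin_on_total[OF l, of u v] hO[of u] hO[of v] CO u v that by auto
        fix z assume z: "z \<in> {y \<in> C. sort N y = Osort}"
          and uv: "less N p (h u) (h v) \<or> h u = h v \<and> less N p u v" and vz: "less N p (h v) (h z) \<or> h v = h z \<and> less N p v z"
        have "h u \<in> O_N" "h v \<in> O_N" "h z \<in> O_N" "u \<in> O_N" "v \<in> O_N" "z \<in> O_N"
          using hO u v z CO by auto
        then show "less N p (h u) (h z) \<or> h u = h z \<and> less N p u z"
          using uv vz tr[of "h u" "h v" "h z"] tr[of u v z] by auto
      qed
    qed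
    show "lin_on {x \<in> X. sort N x = Osort} (rX w)"
      using w
    proof (elim disjE bexE conjE)
      fix p assume "p \<in> C" "sort N p = Psort" "w = Inl p"
      then show ?thesis
        using lin_on_mono[OF lin XO, of "h p"] hN h_sort by (auto simp: rX_def carrier_def)
    next
      fix p assume "p \<in> X" "sort N p = Psort" "w = Inr p"
      then show ?thesis
        using lin_on_mono[OF lin XO, of p] XN by (auto simp: rX_def carrier_def)
    qed
    show "G w z v" if A: "u \<in> C" "sort N u = Osort" "z \<in> C" "sort N z = Osort" "v \<in> X" "sort N v = Osort"
      "rA w z u" "G w u v" for u z v
      using w
    proof (elim disjE bexE conjE)
      fix p assume p: "p \<in> C" "sort N p = Psort" "w = Inl p"
      obtain j x where j: "j \<in> J" "x \<in> set b" "k j (h p) = p" "sort N x = Osort" "u = k j x \<or> less N p u (k j x)" "less N (h p) x v"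
        using A(8) by (auto simp: G_def p(3))
      have "p \<in> P_N" "z \<in> O_N" "u \<in> O_N" "k j x \<in> O_N"
        using p A(1-4) CN kC[OF j(1,2)] j(2,4) k_sort[of x j] by (auto simp: carrier_def)
      then have "less N p z (k j x)"
        using A(7) j(5) lin_on_trans[OF lin, of p z u "k j x"] by (auto simp: rA_def p(3))
      then show ?thesis
        using j by (auto simp: G_def p(3))
    next
      fix p assume p: "p \<in> X" "sort N p = Psort" "w = Inr p"
      have "p \<in> P_N" "h z \<in> O_N" "h u \<in> O_N" "v \<in> O_N"
        using p A(1-6) hO XN by (auto simp: carrier_def)
      then show ?thesis
        using A(7,8) lin_on_trans[OF lin, of p "h z" "h u" v] by (auto simp: rA_def G_def p(3))
    qed
    show "G w u z" if A: "u \<in> C" "sort N u = Osort" "v \<in> X" "sort N v = Osort" "z \<in> X" "sort N z = Osort"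
      "rX w v z" "G w u v" for u v z
      using w
    proof (elim disjE bexE conjE)
      fix p assume p: "p \<in> C" "sort N p = Psort" "w = Inl p"
      obtain j x where j: "j \<in> J" "x \<in> set b" "k j (h p) = p" "sort N x = Osort" "u = k j x \<or> less N p u (k j x)" "less N (h p) x v"
        using A(8) by (auto simp: G_def p(3))
      have "h p \<in> P_N" "x \<in> O_N" "v \<in> O_N" "z \<in> O_N"
        using p A(3-6) XN hN h_sort j(2,4) b by (auto simp: carrier_def)
      then have "less N (h p) x z"
        using A(7) j(6) lin_on_trans[OF lin, of "h p" x v z] by (auto simp: rX_def p(3))
      then show ?thesis
        using j by (auto simp: G_def p(3))
    next
      fix p assume p: "p \<in> X" "sort N p = Psort" "w = Inr p"
      have "p \<in> P_N" "h u \<in> O_N" "z \<in> O_N" "v \<in> O_N"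
        using p A(1-6) hO XN by (auto simp: carrier_def)
      then show ?thesis
        using A(7,8) lin_on_trans[OF lin, of p "h u" v z] by (auto simp: rX_def G_def p(3))
    qed
  qed
  have inv: "embedding (inv_into C Inl) (induced E (Inl ` C)) N"
    by (rule embedding_inv) (use CN in \<open>auto simp: E_def embedding_induced_iff rA_def\<close>)
  have fin: "finite (univ E)" "Inl ` C \<subseteq> univ E"
    using J(1) by (auto simp: E_def C_def X_def)
  obtain f where f: "embedding f (induced E (univ E)) N" and f': "\<And>x. x \<in> Inl ` C \<Longrightarrow> f x = inv_into C Inl x"
    by (rule embedding_extension[OF E fin(1) subset_refl fin(2) inv]) blast
  have fC: "f (Inl u) = u" if "u \<in> C" for u
    using f' that by simp
  \<comment> \<open>An entry shared with \<open>b\<close> lies in \<open>M\<close> and is its own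
    copy in every \<open>cs j\<close>; the others come from the amalgam.\<close>
  define a' where "a' = map (\<lambda>x. if x \<in> set b then x else f (Inr x)) a"
  have fX: "f (Inr x) \<in> univ N \<and> sort N (f (Inr x)) = sort N x" if "x \<in> set a" "x \<notin> set b" for x
    using embedding_univ[OF f, of "Inr x"] embedding_sort[OF f, of "Inr x"] that by (auto simp: E_def X_def)
  have a': "a' \<in> tuples N (sorts N a)"
    using a fX by (auto simp: a'_def tuples_def sorts_def)
  have "sat N (a' @ cs j) \<phi>" if j: "j \<in> J" for j
  proof -
    define g where "g x = (if x \<in> set b then Inl (k j x) else Inr x)" for x
    \<comment> \<open>The demands of the other copies do not disturb the relation of
      \<open>cs j\<close> to the new points.\<close>
    have gG: "G (Inl (k j q)) (k j y) z \<longleftrightarrow> less N q y z"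
      if q: "q \<in> set b" "sort N q = Psort" and y: "y \<in> set b" "sort N y = Osort" and z: "z \<in> X" "sort N z = Osort" for q y z
    proof
      assume "less N q y z"
      then show "G (Inl (k j q)) (k j y) z"
        using j q y hk[OF j q(1)] by (auto simp: G_def intro!: bexI[of _ j] bexI[of _ y])
    next
      assume "G (Inl (k j q)) (k j y) z"
      then obtain i x where i: "i \<in> J" "x \<in> set b" "k i q = k j q" "sort N x = Osort"
        "k j y = k i x \<or> less N (k j q) (k j y) (k i x)" "less N q x z"
        using hk[OF j q(1)] by (auto simp: G_def)
      have P: "q \<in> P_N" and O: "x \<in> O_N" "y \<in> O_N" "z \<in> O_N"
        using q y z i(2,4) b XN by (auto simp: carrier_def)
      note l = lin[OF P]
      have zb: "z \<notin> set b" "z \<in> set a"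
        using z by (auto simp: X_def)
      show "less N q y z"
      \<comment> \<open>Otherwise \<open>x < z < y\<close> while the copy \<open>k j y\<close> is at
        most \<open>k i x\<close>. Then \<open>i\<close> and \<open>j\<close> differ, so
        \<open>q\<close> is in \<open>M\<close>, and \<open>no_gap\<close> yields \<open>m\<close>
        in \<open>M\<close> between \<open>x\<close> and \<open>y\<close>. Both copies must equal
        \<open>m\<close>, whence \<open>x = y\<close>.\<close>
      proof (rule ccontr)
        assume "\<not> less N q y z"
        then have zy: "less N q z y"
          using lin_on_total[OF l O(2,3)] zb y by auto
        have xy: "less N q x y"
          using lin_on_trans[OF l O(1,3,2) i(6) zy] .
        have ij: "i \<noteq> j"
        proof
          assume "i = j"
          then have "y = x \<or> less N q y x"
            using i(5) k_eq[OF y(1) i(2), of j j] k_less[of q y x j] q y i(2,4) by auto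
          then show False
            using xy lin_on_asym[OF l O(1,2)] lin_on_irrefl[OF l O(1)] by auto
        qed
        then have "k i q \<in> M"
          using i(3) k_eq[OF q(1) q(1), of i j] by auto
        then have qM: "q \<in> M" "k j q = q" "k i q = q"
          using k_M[OF q(1), of i] i(3) by auto
        have "\<not> gap q x y"
          using no_gap[OF q(1) qM(1) P i(2) y(1) zb(2) O(3) _ i(6) zy] by blast
        then obtain m where m: "m \<in> M" "sort N m = Osort" "\<not> less N q m x" "\<not> less N q y m"
          using xy O by (auto simp: gap_def)
        have mO: "m \<in> O_N"
          using m M(1) by (auto simp: carrier_def)
        have "x = m \<or> less N q x m" "y = m \<or> less N q m y"
          using lin_on_total[OF l O(1) mO] lin_on_total[OF l O(2) mO] m by auto
        then have c: "k i x = m \<or> less N q (k i x) m" "k j y = m \<or> less N q m (k j y)"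
          using k_less[of q x m i] k_less[of q m y j] kM[OF m(1)] qM q m i(2,4) y by auto
        have kO: "k i x \<in> O_N" "k j y \<in> O_N"
          using kC[OF i(1,2)] kC[OF j y(1)] CN k_sort[of x i] k_sort[of y j] i(2,4) y by (auto simp: carrier_def)
        have "k i x = m" "k j y = m"
          using c i(5) qM(2) lin_on_asym[OF l kO(1) mO] lin_on_asym[OF l kO(2) mO] lin_on_asym[OF l mO kO(2)]
            lin_on_trans[OF l kO(1) mO kO(2)] lin_on_trans[OF l kO(2,1) mO] lin_on_irrefl[OF l mO] lin_on_asym[OF l kO]
          by auto
        then have "x = y"
          using k_M[OF i(2), of i] k_M[OF y(1), of j] m(1) by auto
        then show False
          using xy lin_on_irrefl[OF l O(1)] by simp
      qed
    qed
    have neg: "\<not> less N q z y \<longleftrightarrow> less N q y z" if "q \<in> P_N" "y \<in> O_N" "z \<in> O_N" "y \<noteq> z" for q y z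
      using lin_on_total[OF lin[OF that(1)] that(2,3)] lin_on_asym[OF lin[OF that(1)] that(2,3)] that(4) by blast
    have "embedding g (induced N (set (a @ b))) E"
      unfolding embedding_induced_iff
    proof (intro conjI ballI impI)
      show "inj_on g (set (a @ b))"
        using k_eq[of _ _ j j] by (auto simp: inj_on_def g_def)
      show "g ` set (a @ b) \<subseteq> univ E"
        using kC[OF j] by (auto simp: g_def E_def X_def)
      show "sort E (g x) = sort N x" if "x \<in> set (a @ b)" for x
        using k_sort[of x j] by (auto simp: g_def E_def)
      fix q y z assume A: "q \<in> set (a @ b)" "y \<in> set (a @ b)" "z \<in> set (a @ b)"
        "sort N q = Psort" "sort N y = Osort" "sort N z = Osort"
      have P: "q \<in> P_N" "y \<in> O_N" "z \<in> O_N"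
        using A a b by (auto simp: carrier_def)
      have X: "w \<in> X" if "w \<in> set (a @ b)" "w \<notin> set b" for w
        using that by (auto simp: X_def)
      show "less E (g q) (g y) (g z) = less N q y z"
      proof (cases "q \<in> set b")
        case True
        have 1: ?thesis if "y \<in> set b" "z \<in> set b"
          using that True A k_less[of q y z j] by (simp add: g_def E_def rA_def)
        have 2: ?thesis if "y \<in> set b" "z \<notin> set b"
          using that True A gG[of q y z] X[of z] by (simp add: g_def E_def)
        have 3: ?thesis if "y \<notin> set b" "z \<in> set b"
          using that True A gG[of q z y] X[of y] neg[OF P] by (auto simp: g_def E_def)
        have 4: ?thesis if "y \<notin> set b" "z \<notin> set b"
          using that True hk[OF j True] by (simp add: g_def E_def rX_def)
        from 1 2 3 4 show ?thesis by blast
      next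
        case False
        then show ?thesis
          using hk[OF j] neg[OF P] lin_on_irrefl[OF lin[OF P(1)] P(2)] lin_on_irrefl[OF lin[OF P(1)], of "k j y"]
            kC[OF j, of y] CN k_sort[of y j] A
          by (auto simp: g_def E_def rA_def rX_def G_def carrier_def)
      qed
    qed
    then have fg: "embedding (f \<circ> g) (induced N (set (a @ b))) N"
      using f by (intro embedding_comp_univ) (simp_all add: induced_def)
    have "map (f \<circ> g) (a @ b) = a' @ cs j"
    proof -
      have "map (f \<circ> g) b = cs j"
        using fC kC[OF j] by (auto simp: g_def simp flip: k(2))
      moreover have "map (f \<circ> g) a = a'"
      proof -
        have "f (Inl (k j x)) = x" if "x \<in> set a" "x \<in> set b" for x
          using fC[OF kC[OF j that(2)]] kM[of x j] that ab by auto
        then show ?thesis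
          by (auto simp: a'_def g_def)
      qed
      ultimately show ?thesis by simp
    qed
    moreover have "sat N (map (f \<circ> g) (a @ b)) \<phi> \<longleftrightarrow> sat N (a @ b) \<phi>"
      by (rule sat_embedding[OF fg]) (use a b wf in \<open>auto simp: sorts_def\<close>)
    ultimately show ?thesis
      using sat by simp
  qed
  then show "\<exists>a\<in>tuples N (sorts N a). realizes N a p0"
    using a' J(2) by (auto simp: realizes_def)
qed

end

section \<open>Kim-strict types\<close>

context DLOp_monster
begin

text \<open>\<open>bs j\<close> realizes \<open>q\<close> over \<open>M\<close> and
  \<open>bs i\<close>, so by strictness \<open>bs i\<close> is Kim-independent from
  \<open>bs j\<close>. A point of \<open>bs i\<close> inside the interval would satisfy a formula
  that Kim-divides by \<open>gap_kim_divides\<close>.\<close>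

lemma kim_strict_not_between:
  assumes q: "kim_strict \<kappa> N M \<sigma> q" and bs: "morley_sequence N M \<sigma> q bs" and ij: "i < j"
    and p: "p \<in> P_N" "p \<in> M" and g: "gap p d e" and de: "d \<in> set (bs j)" "e \<in> set (bs j)"
    and c: "c \<in> set (bs i)" "c \<in> O_N"
  shows "\<not> (less N p d c \<and> less N p c e)"
proof
  assume l: "less N p d c \<and> less N p c e"
  let ?\<chi> = "Conj (Less 1 2 0) (Less 1 0 3)"
  have deO: "d \<in> O_N" "e \<in> O_N"
    using g by (auto simp: gap_def)
  have "realizes N (bs j) (restrict_type q (M \<union> set (bs i)))"
    using bs ij unfolding morley_sequence_def realizes_def restrict_type_def by blast
  then have "kim_indep N M (set (bs i)) (set (bs j))"
    using q morley_univ[OF bs] morley_sorts[OF bs] small_finite[OF finite_set]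
    unfolding kim_strict_def tuples_def by blast
  moreover have "set [c] \<subseteq> set (bs i)"
    using c(1) by simp
  moreover have "(?\<chi>, [p, d, e]) \<in> tp N (M \<union> set (bs j)) [c]"
    using l p de deO c by (auto simp: tp_def formulas_over_def sorts_def carrier_def numeral_2_eq_2 numeral_3_eq_3)
  ultimately have "\<not> kim_forks N M (sorts N [c]) ?\<chi> [p, d, e]"
    unfolding kim_indep_def by blast
  moreover have "sorts N [c] = [Osort]"
    using c(2) by (simp add: sorts_def carrier_def)
  moreover have "kim_forks N M [Osort] ?\<chi> [p, d, e]"
    unfolding kim_forks_def
    by (rule exI[of _ "{(?\<chi>, [p, d, e])}"])
      (use gap_kim_divides[OF p g] p deO in
        \<open>auto simp: formulas_over_def sorts_def carrier_def numeral_2_eq_2 numeral_3_eq_3\<close>)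
  ultimately show False
    by simp
qed

text \<open>Such a \<open>q\<close> would put variable \<open>l\<close> to the right of
  \<open>d\<close> and variable \<open>m\<close> to the left of \<open>e\<close>. Replacing
  \<open>d\<close> by a conjugate \<open>c\<close> to the right of \<open>e\<close>, invariance
  would put variable \<open>l\<close> to the right of variable \<open>m\<close>, against the order
  of the two.\<close>

lemma morley_not_nested:
  assumes q: "invariant_type N M \<sigma> q" and bs: "morley_sequence N M \<sigma> q bs" and ij: "i < j"
    and p: "p \<in> P_N" "p \<in> M" and lm: "l < length \<sigma>" "m < length \<sigma>"
    and g: "gap p (bs i ! l) (bs i ! m)" and g': "gap p (bs j ! l) (bs j ! m)"
  shows "\<not> (less N p (bs i ! l) (bs j ! l) \<and> less N p (bs j ! m) (bs i ! m))"
proof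
  assume A: "less N p (bs i ! l) (bs j ! l) \<and> less N p (bs j ! m) (bs i ! m)"
  have gl: "global_type N \<sigma> q"
    using q by (simp add: invariant_type_def)
  let ?n = "length \<sigma>"
  have len: "length (bs i) = ?n" for i
    using morley_sorts[OF bs, of i] by (auto simp: sorts_def)
  define d e where "d = bs i ! l" and "e = bs i ! m"
  have de: "d \<in> set (bs i)" "e \<in> set (bs i)"
    using lm len by (auto simp: d_def e_def)
  have deO: "d \<in> O_N" "e \<in> O_N"
    using g by (simp_all add: gap_def d_def e_def)
  have "\<sigma> ! k = sort N (bs i ! k)" if "k < length \<sigma>" for k
    using morley_sorts[OF bs, of i] that len by (metis nth_map sorts_def)
  then have so: "\<sigma> ! l = Osort" "\<sigma> ! m = Osort"
    using deO lm by (simp_all add: d_def e_def carrier_def)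
  obtain c where c: "c \<in> O_N" "less N p e c" "equiv_over N M [p, d] [p, c]"
    using right_conjugate[OF p g] by (auto simp: d_def e_def)
  \<comment> \<open>The parameters \<open>p\<close> and \<open>y\<close> have the indices
    \<open>?n\<close> and \<open>Suc ?n\<close>: variable \<open>l\<close> exceeds \<open>y\<close>,
    variable \<open>m\<close> is below \<open>y\<close>, and variable \<open>l\<close> is below
    variable \<open>m\<close>.\<close>
  let ?L = "Less ?n (Suc ?n) l" and ?R = "Less ?n m (Suc ?n)" and ?B = "Less ?n l m"
  have pN: "sort N p = Psort" "p \<in> univ N"
    using p(1) by (auto simp: carrier_def)
  have wf: "wf_fm (\<sigma> @ sorts N [p, y]) ?L" "wf_fm (\<sigma> @ sorts N [p, y]) ?R" "wf_fm (\<sigma> @ sorts N [p, y]) ?B" if "y \<in> O_N" for y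
    using that pN lm so by (auto simp: sorts_def nth_append carrier_def)
  have sub: "set [p, y] \<subseteq> M \<union> (\<Union>j'<j. set (bs j'))" if "y \<in> set (bs i)" for y
    using that p(2) ij by auto
  have "(?L, [p, d]) \<in> q" "(?R, [p, e]) \<in> q" "(?B, [p, d]) \<in> q"
    using morley_in_type[OF gl bs sub wf(1), of d] morley_in_type[OF gl bs sub wf(2), of e]
      morley_in_type[OF gl bs sub wf(3), of d] de deO A g' lm len
    by (simp_all add: nth_append d_def e_def gap_def)
  moreover have "(?L, [p, d]) \<in> q \<longleftrightarrow> (?L, [p, c]) \<in> q"
    using q c wf(1)[OF deO(1)] pN deO(1) unfolding invariant_type_def by (auto simp: carrier_def)
  ultimately have "finite {(?L, [p, c]), (?R, [p, e]), (?B, [p, d])} \<and> {(?L, [p, c]), (?R, [p, e]), (?B, [p, d])} \<subseteq> q"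
    by simp
  then obtain a where a: "a \<in> tuples N \<sigma>" "realizes N a {(?L, [p, c]), (?R, [p, e]), (?B, [p, d])}"
    using gl unfolding global_type_def consistent_def by meson
  then have la: "length a = ?n" "a ! l \<in> O_N" "a ! m \<in> O_N"
    using lm so by (auto simp: tuples_def sorts_def carrier_def)
  then have "less N p c (a ! l)" "less N p (a ! m) e" "less N p (a ! l) (a ! m)"
    using a(2) lm by (auto simp: realizes_def nth_append)
  then have "less N p c e"
    using lin_on_trans[OF lin[OF p(1)]] la c(1) deO(2) by blast
  then show False
    using c lin_on_asym[OF lin[OF p(1)]] deO(2) by blast
qed

text \<open>Inconsistency along the witness \<open>cs\<close> of Kim-dividing and
  \<open>consistent_along\<close> leave every solution of an instance with one of finitely many
  obstructions. Two instances with the same obstruction are incompatible along a Kim-strict Morley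
  sequence.\<close>

lemma kim_divides_imp_universally_kim_strictly_divides:
  assumes form: "(\<phi>, b) \<in> formulas_over N (univ N) \<sigma>" and kd: "kim_divides N M \<sigma> \<phi> b"
  shows "universally_kim_strictly_divides \<kappa> N M \<sigma> \<phi> b"
  unfolding universally_kim_strictly_divides_def divides_along_def
proof (intro allI impI notI)
  fix q bs
  assume "kim_strict \<kappa> N M (sorts N b) q \<and> tp N M b \<subseteq> q \<and> morley_sequence N M (sorts N b) q bs"
  then have q: "kim_strict \<kappa> N M (sorts N b) q" and qb: "tp N M b \<subseteq> q"
    and bs: "morley_sequence N M (sorts N b) q bs" by auto
  have inv: "invariant_type N M (sorts N b) q"
    using q by (simp add: kim_strict_def)
  assume con: "consistent N \<sigma> (range (\<lambda>i. (\<phi>, bs i)))"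
  obtain q0 cs where q0: "invariant_type N M (sorts N b) q0" "tp N M b \<subseteq> q0"
    and cs: "morley_sequence N M (sorts N b) q0 cs" and div: "\<not> consistent N \<sigma> (range (\<lambda>i. (\<phi>, cs i)))"
    using kd unfolding kim_divides_def divides_along_def by blast
  have b: "set b \<subseteq> univ N" "wf_fm (\<sigma> @ sorts N b) \<phi>"
    using form by (auto simp: formulas_over_def)
  have b_bs: "equiv_over N M b (bs i)" for i
    using morley_equiv[OF _ bs qb b(1)] inv by (simp add: invariant_type_def)
  have b_cs: "equiv_over N M b (cs i)" for i
    using morley_equiv[OF _ cs q0(2) b(1)] q0(1) by (simp add: invariant_type_def)
  have bs_cs: "equiv_over N M (bs i) (cs j)" for i j
    using equiv_over_trans[OF equiv_over_sym[OF b_bs] b_cs] .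
  define r where "r = length b"
  have len: "length (bs i) = r" for i
    using morley_sorts[OF bs, of i] by (auto simp: sorts_def r_def dest: map_eq_imp_length_eq)
  let ?n = "length \<sigma>"
  \<comment> \<open>Codes of obstructions: a position in \<open>a\<close>, three positions in
    \<open>b\<close>, and a flag for the kind. Their number does not depend on the instance.\<close>
  define Q where "Q = {..<?n} \<times> {..<r} \<times> {..<r} \<times> {..<r} \<times> (UNIV :: bool set)"
  define bad where "bad a i = (\<lambda>(t, k, l, m, s).
    if s then a ! t = bs i ! l \<and> a ! t \<notin> M
    else bs i ! k \<in> M \<and> bs i ! k \<in> P_N \<and> a ! t \<in> O_N \<and> gap (bs i ! k) (bs i ! l) (bs i ! m) \<and>
      less N (bs i ! k) (bs i ! l) (a ! t) \<and> less N (bs i ! k) (a ! t) (bs i ! m))" for a i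
  have bad_ex: "\<exists>x\<in>Q. bad a i x" if a: "a \<in> tuples N \<sigma>" "sat N (a @ bs i) \<phi>" for a i
  proof (rule ccontr)
    assume no: "\<not> ?thesis"
    have as: "set a \<subseteq> univ N" "sorts N a = \<sigma>" and la: "length a = ?n"
      using a(1) by (auto simp: tuples_def sorts_def)
    have "consistent N (sorts N a) (range (\<lambda>i. (\<phi>, cs i)))"
    proof (rule consistent_along[OF as(1) morley_univ[OF bs] _ a(2) morley_univ[OF cs] bs_cs morley_disjoint[OF q0(1) cs]])
      show "wf_fm (sorts N a @ sorts N (bs i)) \<phi>"
        using b(2) as(2) morley_sorts[OF bs, of i] by simp
      show "set a \<inter> set (bs i) \<subseteq> M"
      proof (rule subsetI, rule ccontr)
        fix x assume x: "x \<in> set a \<inter> set (bs i)" "x \<notin> M"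
        then obtain t l where "t < ?n" "l < r" "a ! t = x" "bs i ! l = x"
          using la len by (metis IntE in_set_conv_nth)
        \<comment> \<open>A shared element involves a single position of \<open>b\<close>;
          \<open>l\<close> also fills the other two slots.\<close>
        then have "(t, l, l, l, True) \<in> Q" "bad a i (t, l, l, l, True)"
          using x by (auto simp: Q_def bad_def)
        then show False
          using no by blast
      qed
      fix p d e y
      assume A: "p \<in> set (bs i)" "p \<in> M" "p \<in> P_N" "d \<in> set (bs i)" "e \<in> set (bs i)" "y \<in> set a" "y \<in> O_N"
        "gap p d e" "less N p d y" "less N p y e"
      then obtain t k l m where "t < ?n" "k < r" "l < r" "m < r" "a ! t = y" "bs i ! k = p" "bs i ! l = d" "bs i ! m = e"
        using la len by (metis in_set_conv_nth)
      then have "(t, k, l, m, False) \<in> Q" "bad a i (t, k, l, m, False)"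
        using A by (auto simp: Q_def bad_def)
      then show False
        using no by blast
    qed
    then show False
      using div as(2) by simp
  qed
  have finQ: "finite Q"
    by (auto simp: Q_def)
  \<comment> \<open>One index more than there are codes, so two indices receive the same
    one.\<close>
  define I where "I = {..card Q}"
  have "finite ((\<lambda>i. (\<phi>, bs i)) ` I) \<and> (\<lambda>i. (\<phi>, bs i)) ` I \<subseteq> range (\<lambda>i. (\<phi>, bs i))"
    by (auto simp: I_def)
  then obtain a where a: "a \<in> tuples N \<sigma>" "realizes N a ((\<lambda>i. (\<phi>, bs i)) ` I)"
    using con unfolding consistent_def by meson
  have "\<forall>i\<in>I. \<exists>x\<in>Q. bad a i x"
    using bad_ex[OF a(1)] a(2) by (auto simp: realizes_def)
  then obtain F where F: "\<And>i. i \<in> I \<Longrightarrow> F i \<in> Q" "\<And>i. i \<in> I \<Longrightarrow> bad a i (F i)"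
    by metis
  have "\<not> inj_on F I"
  proof
    assume "inj_on F I"
    then have "card I \<le> card Q"
      using F(1) finQ by (intro card_inj_on_le) auto
    then show False
      by (simp add: I_def)
  qed
  then obtain i j where "i \<in> I" "j \<in> I" "F i = F j" "i < j"
    unfolding inj_on_def by (metis linorder_neqE_nat)
  moreover obtain t k l m s where "F i = (t, k, l, m, s)"
    by (metis prod_cases5)
  ultimately have ij: "i < j" and Q: "k < r" "l < r" "m < r" and Bi: "bad a i (t, k, l, m, s)" and Bj: "bad a j (t, k, l, m, s)"
    using F(1)[of i] F(2)[of i] F(2)[of j] by (auto simp: Q_def)
  have in_bs: "bs i' ! k' \<in> set (bs i')" if "k' < r" for i' k'
    using that len by simp
  show False
  proof (cases s)
    case True
    then show False
      using Bi Bj morley_disjoint[OF inv bs ij] in_bs[OF Q(2), of i] in_bs[OF Q(2), of j]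
      by (auto simp: bad_def)
  next
    case False
    define p where "p = bs i ! k"
    define y where "y = a ! t"
    have p: "p \<in> M" "p \<in> P_N"
      using Bi False by (auto simp: bad_def p_def)
    have y: "y \<in> O_N"
      using Bi False by (auto simp: bad_def y_def)
    have pj: "bs j ! k = p"
    proof -
      obtain g where "map g (bs i) = bs j" "\<And>m. m \<in> M \<Longrightarrow> g m = m"
        using equiv_over_embedding[OF equiv_over_trans[OF equiv_over_sym[OF b_bs] b_bs] morley_univ[OF bs] morley_univ[OF bs] M(1)]
        by metis
      then show ?thesis
        using p(1) Q(1) len unfolding p_def by (metis nth_map)
    qed
    define d e d' e' where "d = bs i ! l" and "e = bs i ! m" and "d' = bs j ! l" and "e' = bs j ! m"
    have g: "gap p d e" "gap p d' e'" and l: "less N p d y" "less N p y e" "less N p d' y" "less N p y e'"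
      using Bi Bj False pj by (auto simp: bad_def p_def[symmetric] y_def d_def e_def d'_def e'_def)
    have O: "d \<in> O_N" "e \<in> O_N" "d' \<in> O_N" "e' \<in> O_N"
      using g by (auto simp: gap_def)
    have ins: "d \<in> set (bs i)" "e \<in> set (bs i)" "d' \<in> set (bs j)" "e' \<in> set (bs j)"
      using in_bs Q by (auto simp: d_def e_def d'_def e'_def)
    have nM: "d \<notin> M" "e \<notin> M"
      using gap_notin[OF p(2) g(1)] by auto
    have neq: "d \<noteq> d'" "e \<noteq> e'"
      using morley_disjoint[OF inv bs ij] ins nM by auto
    note L = lin[OF p(2)]
    note nb = kim_strict_not_between[OF q bs ij p(2,1) g(2) ins(3,4)]
    \<comment> \<open>Both intervals contain \<open>y\<close>, so \<open>d\<close> is below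
      \<open>e'\<close> and \<open>d'\<close> is below \<open>e\<close>. As neither \<open>d\<close>
      nor \<open>e\<close> lies strictly between \<open>d'\<close> and \<open>e'\<close>, the second
      interval is nested in the first.\<close>
    have "less N p d d'"
      using nb[OF ins(1) O(1)] lin_on_total[OF L O(1,3)] neq(1) lin_on_trans[OF L O(1) y O(4) l(1,4)] by blast
    moreover have "less N p e' e"
      using nb[OF ins(2) O(2)] lin_on_total[OF L O(2,4)] neq(2) lin_on_trans[OF L O(3) y O(2) l(3,2)] by blast
    ultimately show False
      using morley_not_nested[OF inv bs ij p(2,1), of l m] g Q
      by (simp add: d_def e_def d'_def e'_def sorts_def r_def)
  qed
qed

end

theorem theorem4p4:
  shows "new_kims_lemma TYPE('a) DLOp"
  unfolding new_kims_lemma_def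
proof (intro allI impI)
  fix \<kappa> :: "'a rel" and N M \<sigma> \<phi> b
  assume "monster DLOp \<kappa> N \<and> elementary_sub M N \<and> |M| <o \<kappa>"
    and *: "(\<phi>, b) \<in> formulas_over N (univ N) \<sigma> \<and> kim_divides N M \<sigma> \<phi> b"
  then interpret DLOp_monster N \<kappa> M
    by unfold_locales (auto simp: monster_def elementary_sub_def)
  show "universally_kim_strictly_divides \<kappa> N M \<sigma> \<phi> b"
    using * kim_divides_imp_universally_kim_strictly_divides by blast
qed

end
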